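(* Let $F:(\mathbb{C}^n,0)\to(\mathbb{C}^p,0)$, $n\ge p$, be a holomorphic map germ. If the fibre $F^{-1}(0)$ has dimension $n-p$, then $(\operatorname{Im}F,0)=(\mathbb{C}^p,0)$. If moreover $\operatorname{Sing}F\cap F^{-1}(0)=\{0\}$, then $F$ is a nice map germ (NMG).
   Context: All sets are considered as germs at the origin. Two subsets $A,A'$ have the same germ at $0$, written $(A,0)=(A',0)$, if $A\cap B=A'\cap B$ for some open ball $B$ centred at $0$. $B_\varepsilon$ is the open ball of radius $\varepsilon$ centred at $0$ in the source. For a set germ $K$ at $0$ in the source, $F(K)$ is a well-defined set germ at $0$ if $(F(B_\varepsilon\cap K),0)=(F(B_{\varepsilon'}\cap K),0)$ for all small enough $\varepsilon,\varepsilon'>0$; $\operatorname{Im}F$ corresponds to $K$ being the whole source, and $(\operatorname{Im}F,0)=(\mathbb{C}^p,0)$ means that it is well-defined and equal to the full germ $(\mathbb{C}^p,0)$. $\operatorname{Sing}F$ is the set of points where $F$ is not a submersion (complex rank of the differential $<p$). $F$ is a nice map germ (NMG) if both $\operatorname{Im}F$ and $F(\operatorname{Sing}F)$ are well-defined set germs at $0$. *)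

theory Defs
  imports "HOL-Analysis.Analysis" "HOL-Algebra.QuotRing" "HOL-Library.Extended_Nat"
begin

section \<open>Holomorphic germs in several variables\<close>

definition complex_differentiable_at ::
    "((complex, 'n::finite) vec \<Rightarrow> complex) \<Rightarrow> (complex, 'n) vec \<Rightarrow> bool" where
  "complex_differentiable_at f z \<longleftrightarrow>
     (\<exists>f'. (f has_derivative f') (at z) \<and> (\<forall>c v. f' (c *s v) = c * f' v))"

definition holomorphic_near_0 :: "((complex, 'n::finite) vec \<Rightarrow> complex) \<Rightarrow> bool" where
  "holomorphic_near_0 f \<longleftrightarrow>
     (\<exists>U. open U \<and> 0 \<in> U \<and> (\<forall>z\<in>U. complex_differentiable_at f z))"

text \<open>A map germ \<open>(\<complex>\<^sup>n, 0) \<rightarrow> (\<complex>\<^sup>p, 0)\<close> is given by a representative, extended arbitrarily to a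
  total function. All notions below depend only on the germ at the origin.\<close>

definition holomorphic_map_germ ::
    "((complex, 'n::finite) vec \<Rightarrow> (complex, 'p::finite) vec) \<Rightarrow> bool" where
  "holomorphic_map_germ F \<longleftrightarrow> F 0 = 0 \<and> (\<forall>i. holomorphic_near_0 (\<lambda>z. F z $ i))"

section \<open>Set germs and images\<close>

definition set_germ_eq :: "'a::real_normed_vector set \<Rightarrow> 'a set \<Rightarrow> bool" where
  "set_germ_eq A B \<longleftrightarrow> (\<exists>r>0. A \<inter> ball 0 r = B \<inter> ball 0 r)"

definition well_defined_image ::
    "('a::real_normed_vector \<Rightarrow> 'b::real_normed_vector) \<Rightarrow> 'a set \<Rightarrow> bool" where
  "well_defined_image F K \<longleftrightarrow>
     (\<exists>r>0. \<forall>\<epsilon> \<epsilon>'. 0 < \<epsilon> \<and> \<epsilon> < r \<and> 0 < \<epsilon>' \<and> \<epsilon>' < r \<longrightarrow>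
        set_germ_eq (F ` (ball 0 \<epsilon> \<inter> K)) (F ` (ball 0 \<epsilon>' \<inter> K)))"

definition image_germ_eq ::
    "('a::real_normed_vector \<Rightarrow> 'b::real_normed_vector) \<Rightarrow> 'a set \<Rightarrow> 'b set \<Rightarrow> bool" where
  "image_germ_eq F K B \<longleftrightarrow>
     well_defined_image F K \<and>
     (\<exists>r>0. \<forall>\<epsilon>. 0 < \<epsilon> \<and> \<epsilon> < r \<longrightarrow> set_germ_eq (F ` (ball 0 \<epsilon> \<inter> K)) B)"

text \<open>Where \<open>F\<close> is holomorphic, the Frechet derivative over the reals is complex linear, and
  the matrix below is the complex Jacobian matrix.\<close>

definition Sing :: "((complex, 'n::finite) vec \<Rightarrow> (complex, 'p::finite) vec) \<Rightarrow> (complex, 'n) vec set"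
  where "Sing F = {z. rank (matrix (frechet_derivative F (at z))) < CARD('p)}"

definition nice_map_germ ::
    "((complex, 'n::finite) vec \<Rightarrow> (complex, 'p::finite) vec) \<Rightarrow> bool" where
  "nice_map_germ F \<longleftrightarrow> well_defined_image F UNIV \<and> well_defined_image F (Sing F)"

section \<open>Dimension of a set germ at the origin\<close>

text \<open>The supremum of the lengths \<open>m\<close> of chains \<open>P\<^sub>0 \<subset> \<dots> \<subset> P\<^sub>m\<close> of prime ideals. (By the
  convention for suprema in \<^typ>\<open>enat\<close>, the zero ring gets dimension \<open>0\<close>.)\<close>

definition krull_dim :: "('a, 'b) ring_scheme \<Rightarrow> enat" where
  "krull_dim R = (SUP m \<in> {m. \<exists>P. (\<forall>i\<le>m. primeideal (P i) R) \<and> (\<forall>i<m. P i \<subset> P (Suc i))}. enat m)"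

definition holomorphic_ring :: "((complex, 'n::finite) vec \<Rightarrow> complex) ring" where
  "holomorphic_ring =
     \<lparr>carrier = {f. holomorphic_near_0 f},
      mult = (\<lambda>f g z. f z * g z), one = (\<lambda>z. 1),
      zero = (\<lambda>z. 0), add = (\<lambda>f g z. f z + g z)\<rparr>"

definition vanishing_ideal :: "(complex, 'n::finite) vec set \<Rightarrow> ((complex, 'n) vec \<Rightarrow> complex) set" where
  "vanishing_ideal X = {f. holomorphic_near_0 f \<and> (\<forall>\<^sub>F z in nhds 0. z \<in> X \<longrightarrow> f z = 0)}"

text \<open>The ring of germs at \<open>0\<close> of restrictions to \<open>X\<close> of holomorphic functions. Elements of
  \<^const>\<open>holomorphic_ring\<close> are functions rather than germs, but functions vanishing near \<open>0\<close> lie in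
  every vanishing ideal, so this is the usual \<open>\<O>\<^sub>n / I(X, 0)\<close>.\<close>

definition local_ring :: "(complex, 'n::finite) vec set \<Rightarrow> ((complex, 'n) vec \<Rightarrow> complex) set ring" where
  "local_ring X = holomorphic_ring Quot vanishing_ideal X"

definition germ_dim :: "(complex, 'n::finite) vec set \<Rightarrow> enat" where
  "germ_dim X = krull_dim (local_ring X)"

lemma complex_differentiable_at_const: "complex_differentiable_at (\<lambda>z. c) z"
  unfolding complex_differentiable_at_def by (rule exI[of _ "\<lambda>_. 0"]) auto

lemma complex_differentiable_at_add:
  assumes "complex_differentiable_at f z" "complex_differentiable_at g z"
  shows "complex_differentiable_at (\<lambda>z. f z + g z) z"
proof -
  obtain f' g' where "(f has_derivative f') (at z)" "\<forall>c v. f' (c *s v) = c * f' v"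
      "(g has_derivative g') (at z)" "\<forall>c v. g' (c *s v) = c * g' v"
    using assms unfolding complex_differentiable_at_def by blast
  then show ?thesis
    unfolding complex_differentiable_at_def
    by (intro exI[of _ "\<lambda>v. f' v + g' v"]) (auto intro!: derivative_eq_intros simp: algebra_simps)
qed

lemma complex_differentiable_at_mult:
  assumes "complex_differentiable_at f z" "complex_differentiable_at g z"
  shows "complex_differentiable_at (\<lambda>z. f z * g z) z"
proof -
  obtain f' g' where "(f has_derivative f') (at z)" "\<forall>c v. f' (c *s v) = c * f' v"
      "(g has_derivative g') (at z)" "\<forall>c v. g' (c *s v) = c * g' v"
    using assms unfolding complex_differentiable_at_def by blast
  then show ?thesis
    unfolding complex_differentiable_at_def
    by (intro exI[of _ "\<lambda>v. f z * g' v + f' v * g z"])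
       (auto intro!: derivative_eq_intros simp: algebra_simps)
qed

lemma holomorphic_near_0_const: "holomorphic_near_0 (\<lambda>z. c)"
  unfolding holomorphic_near_0_def by (intro exI[of _ UNIV]) (simp add: complex_differentiable_at_const)

lemma holomorphic_near_0_add:
  assumes "holomorphic_near_0 f" "holomorphic_near_0 g"
  shows "holomorphic_near_0 (\<lambda>z. f z + g z)"
proof -
  obtain U V where "open U" "0 \<in> U" "\<forall>z\<in>U. complex_differentiable_at f z"
      "open V" "0 \<in> V" "\<forall>z\<in>V. complex_differentiable_at g z"
    using assms unfolding holomorphic_near_0_def by blast
  then show ?thesis
    unfolding holomorphic_near_0_def
    by (intro exI[of _ "U \<inter> V"]) (auto intro: complex_differentiable_at_add)
qed

lemma holomorphic_near_0_mult:
  assumes "holomorphic_near_0 f" "holomorphic_near_0 g"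
  shows "holomorphic_near_0 (\<lambda>z. f z * g z)"
proof -
  obtain U V where "open U" "0 \<in> U" "\<forall>z\<in>U. complex_differentiable_at f z"
      "open V" "0 \<in> V" "\<forall>z\<in>V. complex_differentiable_at g z"
    using assms unfolding holomorphic_near_0_def by blast
  then show ?thesis
    unfolding holomorphic_near_0_def
    by (intro exI[of _ "U \<inter> V"]) (auto intro: complex_differentiable_at_mult)
qed

lemma cring_holomorphic_ring: "cring (holomorphic_ring :: ((complex, 'n::finite) vec \<Rightarrow> complex) ring)"
proof (rule cringI)
  show "abelian_group (holomorphic_ring :: ((complex, 'n) vec \<Rightarrow> complex) ring)"
  proof (rule abelian_groupI)
    fix f :: "(complex, 'n) vec \<Rightarrow> complex"
    assume "f \<in> carrier holomorphic_ring"
    then show "\<exists>g\<in>carrier holomorphic_ring. g \<oplus>\<^bsub>holomorphic_ring\<^esub> f = \<zero>\<^bsub>holomorphic_ring\<^esub>"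
      using holomorphic_near_0_mult[OF holomorphic_near_0_const[of "-1"], of f]
      by (intro bexI[of _ "\<lambda>z. - 1 * f z"]) (simp_all add: holomorphic_ring_def)
  qed (auto simp: holomorphic_ring_def add_ac holomorphic_near_0_const holomorphic_near_0_add)
  show "comm_monoid (holomorphic_ring :: ((complex, 'n) vec \<Rightarrow> complex) ring)"
    by (rule comm_monoidI)
       (auto simp: holomorphic_ring_def mult_ac holomorphic_near_0_const holomorphic_near_0_mult)
qed (auto simp: holomorphic_ring_def algebra_simps)

lemma ideal_vanishing_ideal:
  fixes X :: "(complex, 'n::finite) vec set"
  shows "ideal (vanishing_ideal X) holomorphic_ring"
proof -
  interpret cring "holomorphic_ring :: ((complex, 'n) vec \<Rightarrow> complex) ring"
    by (rule cring_holomorphic_ring)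
  let ?R = "holomorphic_ring :: ((complex, 'n) vec \<Rightarrow> complex) ring"
  have minus: "\<ominus>\<^bsub>?R\<^esub> f = (\<lambda>z. - f z)" if "holomorphic_near_0 f" for f :: "(complex, 'n) vec \<Rightarrow> complex"
    using holomorphic_near_0_mult[OF holomorphic_near_0_const[of "-1"] that] that
    by (intro minus_equality) (auto simp: holomorphic_ring_def)
  have minus_closed: "holomorphic_near_0 (\<lambda>z. - f z)" if "holomorphic_near_0 f"
    for f :: "(complex, 'n) vec \<Rightarrow> complex"
    using holomorphic_near_0_mult[OF holomorphic_near_0_const[of "-1"] that] by simp
  show "ideal (vanishing_ideal X) ?R"
  proof (rule idealI)
    show "subgroup (vanishing_ideal X) (add_monoid ?R)"
    proof (rule add.subgroupI)
      fix f assume f: "f \<in> vanishing_ideal X"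
      then have "\<forall>\<^sub>F z in nhds 0. z \<in> X \<longrightarrow> - f z = 0"
        by (auto simp: vanishing_ideal_def elim: eventually_mono)
      with f show "\<ominus>\<^bsub>?R\<^esub> f \<in> vanishing_ideal X"
        by (auto simp: vanishing_ideal_def minus intro: minus_closed)
    next
      fix f g assume "f \<in> vanishing_ideal X" "g \<in> vanishing_ideal X"
      then show "f \<oplus>\<^bsub>?R\<^esub> g \<in> vanishing_ideal X"
        by (auto simp: vanishing_ideal_def holomorphic_ring_def intro: holomorphic_near_0_add
            elim: eventually_elim2)
    next
      have "(\<lambda>z. 0) \<in> vanishing_ideal X"
        by (simp add: vanishing_ideal_def holomorphic_near_0_const)
      then show "vanishing_ideal X \<noteq> {}" by blast
    qed (auto simp: vanishing_ideal_def holomorphic_ring_def)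
  next
    fix f g assume "f \<in> vanishing_ideal X" "g \<in> carrier ?R"
    then show "g \<otimes>\<^bsub>?R\<^esub> f \<in> vanishing_ideal X" "f \<otimes>\<^bsub>?R\<^esub> g \<in> vanishing_ideal X"
      by (auto simp: vanishing_ideal_def holomorphic_ring_def intro: holomorphic_near_0_mult
          elim: eventually_mono)
  qed (rule ring_axioms)
qed

end

theory Submission
  imports Defs "HOL-Complex_Analysis.Complex_Analysis"
begin

text \<open>
  Let \<open>X\<close> be the fibre of \<open>F\<close> over \<open>0\<close>. Among the linear projections \<open>\<complex>\<^sup>n \<rightarrow> \<complex>\<^sup>k\<close> whose kernel meets \<open>X\<close> only
  in \<open>0\<close>, take one with \<open>k\<close> minimal. Its restriction to \<open>X\<close> is finite, so the image of \<open>X\<close> is analytic, and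
  by minimality it is all of \<open>\<complex>\<^sup>k\<close>. Lifting a coordinate flag of \<open>\<complex>\<^sup>k\<close> to \<open>X\<close> gives a chain of \<open>k + 1\<close> primes
  in the local ring, so \<open>k \<le> dim X = n - p\<close>. Hence some \<open>p\<close>-dimensional linear subspace meets \<open>X\<close> only in \<open>0\<close>,
  and the restriction of \<open>F\<close> to it is an equidimensional map with an isolated zero, which is open at \<open>0\<close>.

  If \<open>Sing F\<close> meets \<open>X\<close> only in \<open>0\<close>, then \<open>F\<close> is bounded away from \<open>0\<close> on the compact part of \<open>Sing F\<close>
  between two small spheres, so shrinking the ball does not change the germ of \<open>F(Sing F)\<close>.
\<close>

text \<open>The obstacle is that the dimension is a Krull dimension of a ring of germs, so a
  statement about projections must be turned into prime ideals. The chain of primes does not come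
  from irreducible components or integral extensions: a germ belongs to the ideal if it vanishes at
  almost all points of a family, in the sense of an ultrafilter, and such an ideal is automatically
  prime. Inclusions come from limits, strictness from coordinate functions. The analytic input is
  one tool, the zeros of a function on a disc in a coordinate direction. Power sums of values at
  these zeros are contour integrals, hence holomorphic in the parameter, and so is the product of
  the values. The product detects whether some zero has a given property, which makes projections of
  analytic sets analytic; if there is only one zero, the sums solve an implicit equation. Openness
  of the equidimensional map rests on the fact that fewer than q holomorphic functions of q
  variables have no isolated common zero, which is proved by induction on the number of functions,
  without dimension theory.\<close>

no_notation fps_nth (infixl "$" 75)

section \<open>Holomorphy along complex lines\<close>

lemma norm_vector_smult: "norm (c *s v) = cmod c * norm v" for v :: "(complex, 'n::finite) vec"
  by (simp add: norm_vec_def L2_set_def norm_mult power_mult_distrib real_sqrt_mult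
      flip: sum_distrib_left)

lemma norm_axis: "norm (axis i t :: (complex, 'n::finite) vec) = cmod t"
proof -
  have "axis i t = t *s axis i (1::complex)" by (simp add: vec_eq_iff axis_def)
  moreover have "norm (axis i (1::complex) :: (complex, 'n) vec) = 1"
    by (simp add: norm_vec_def L2_set_def axis_def if_distrib[of norm] if_distrib[of "\<lambda>x. x^2"] cong: if_cong)
  ultimately show ?thesis by (metis norm_vector_smult mult.right_neutral)
qed

lemma continuous_on_vector_smult [continuous_intros]:
  fixes g :: "'a::topological_space \<Rightarrow> (complex, 'n::finite) vec"
  assumes "continuous_on A f" "continuous_on A g"
  shows "continuous_on A (\<lambda>x. f x *s g x)"
  unfolding vector_scalar_mult_def using assms by (intro continuous_intros)

lemma continuous_on_axis [continuous_intros]: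
  fixes f :: "'a::topological_space \<Rightarrow> complex"
  assumes "continuous_on A f"
  shows "continuous_on A (\<lambda>x. axis i (f x) :: (complex, 'n::finite) vec)"
proof -
  have *: "(\<lambda>x. axis i (f x) :: (complex, 'n) vec) = (\<lambda>x. f x *s axis i 1)"
    by (simp add: fun_eq_iff vec_eq_iff axis_def)
  show ?thesis unfolding * by (rule continuous_on_vector_smult[OF assms continuous_on_const])
qed

lemma axis_eq_smult: "axis i t = t *s (axis i 1 :: (complex, 'n::finite) vec)"
  by (simp add: vec_eq_iff axis_def)

lemma open_line: "open U \<Longrightarrow> open {s. z + s *s v \<in> U}" for v :: "(complex, 'a::finite) vec"
  using open_vimage[of U "\<lambda>s. z + s *s v"] by (simp add: vimage_def continuous_intros)

section \<open>Complex linear maps\<close>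

text \<open>\<open>linear\<close> refers to the real scalars of these vectors, so complex linearity
  is stated through \<open>*s\<close>.\<close>

definition clinear_map :: "((complex, 'm::finite) vec \<Rightarrow> (complex, 'n::finite) vec) \<Rightarrow> bool" where
  "clinear_map L \<longleftrightarrow> (\<forall>x y. L (x + y) = L x + L y) \<and> (\<forall>c x. L (c *s x) = c *s L x)"

lemma clinear_mapI [intro?]:
  "(\<And>x y. L (x + y) = L x + L y) \<Longrightarrow> (\<And>c x. L (c *s x) = c *s L x) \<Longrightarrow> clinear_map L"
  by (simp add: clinear_map_def)

lemma clinear_map_add: "clinear_map L \<Longrightarrow> L (x + y) = L x + L y"
  and clinear_map_smult: "clinear_map L \<Longrightarrow> L (c *s x) = c *s L x"
  by (simp_all add: clinear_map_def)

lemma clinear_map_bounded_linear: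
  assumes "clinear_map L" shows "bounded_linear L"
proof -
  have *: "r *\<^sub>R x = complex_of_real r *s x" for r and x :: "(complex, 'k::finite) vec"
    by (simp add: vec_eq_iff) (simp add: scaleR_conv_of_real)
  have "linear L"
    by (rule linearI) (use assms in \<open>auto simp: * clinear_map_def\<close>)
  then show ?thesis by (rule linear_conv_bounded_linear[THEN iffD1])
qed

lemma clinear_map_zero: "clinear_map L \<Longrightarrow> L 0 = 0"
  using clinear_map_bounded_linear linear_simps(3) by blast

lemma clinear_map_continuous_on: "clinear_map L \<Longrightarrow> continuous_on A L"
  by (simp add: clinear_map_bounded_linear linear_continuous_on)

lemma clinear_map_compose: "clinear_map L \<Longrightarrow> clinear_map M \<Longrightarrow> clinear_map (\<lambda>x. L (M x))"
  by (simp add: clinear_map_def)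

lemma clinear_map_small:
  assumes "clinear_map L" "e > 0"
  shows "\<exists>s>0. \<forall>x\<in>ball 0 s. L x \<in> ball 0 e"
proof -
  obtain B where B: "B > 0" "\<And>x. norm (L x) \<le> norm x * B"
    using bounded_linear.pos_bounded[OF clinear_map_bounded_linear[OF assms(1)]] by blast
  have "norm (L x) < e" if "norm x < e / B" for x
    using B(2)[of x] that B(1) by (simp add: pos_less_divide_eq)
  then show ?thesis using B(1) assms(2) by (intro exI[of _ "e / B"]) auto
qed

text \<open>Continuity together with holomorphy on complex lines: by Hartogs--Osgood this is the usual
  notion of holomorphy in several variables, but it is easier to verify for integrals depending on
  parameters.\<close>

definition gholo :: "(complex, 'n::finite) vec set \<Rightarrow> ((complex, 'n) vec \<Rightarrow> complex) \<Rightarrow> bool" where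
  "gholo U f \<longleftrightarrow>
     continuous_on U f \<and> (\<forall>z v. (\<lambda>s. f (z + s *s v)) holomorphic_on {s. z + s *s v \<in> U})"

lemma gholoI:
  assumes "continuous_on U f" "\<And>z v. (\<lambda>s. f (z + s *s v)) holomorphic_on {s. z + s *s v \<in> U}"
  shows "gholo U f"
  using assms by (simp add: gholo_def)

lemma gholo_continuous_on: "gholo U f \<Longrightarrow> continuous_on U f"
  and gholo_line: "gholo U f \<Longrightarrow> (\<lambda>s. f (z + s *s v)) holomorphic_on {s. z + s *s v \<in> U}"
  by (simp_all add: gholo_def)

lemma gholo_axis:
  "gholo U f \<Longrightarrow> (\<lambda>t. f (z + axis i t)) holomorphic_on {t. z + axis i t \<in> U}"
  using gholo_line[of U f z "axis i 1"] by (simp flip: axis_eq_smult)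

lemma gholo_subset: "gholo U f \<Longrightarrow> V \<subseteq> U \<Longrightarrow> gholo V f"
  unfolding gholo_def by (blast intro: continuous_on_subset holomorphic_on_subset)

lemma gholo_const: "gholo U (\<lambda>z. c)"
  by (auto simp: gholo_def)

lemma gholo_add: "gholo U f \<Longrightarrow> gholo U g \<Longrightarrow> gholo U (\<lambda>z. f z + g z)"
  by (auto simp: gholo_def intro!: continuous_intros holomorphic_intros)

lemma gholo_diff: "gholo U f \<Longrightarrow> gholo U g \<Longrightarrow> gholo U (\<lambda>z. f z - g z)"
  by (auto simp: gholo_def intro!: continuous_intros holomorphic_intros)

lemma gholo_mult: "gholo U f \<Longrightarrow> gholo U g \<Longrightarrow> gholo U (\<lambda>z. f z * g z)"
  by (auto simp: gholo_def intro!: continuous_intros holomorphic_intros)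

lemma gholo_divide:
  "gholo U f \<Longrightarrow> gholo U g \<Longrightarrow> (\<And>z. z \<in> U \<Longrightarrow> g z \<noteq> 0) \<Longrightarrow> gholo U (\<lambda>z. f z / g z)"
  by (auto simp: gholo_def intro!: continuous_intros holomorphic_intros)

lemma gholo_power: "gholo U f \<Longrightarrow> gholo U (\<lambda>z. f z ^ k)"
  by (auto simp: gholo_def intro!: continuous_intros holomorphic_intros)

lemma gholo_sum: "(\<And>i. i \<in> I \<Longrightarrow> gholo U (f i)) \<Longrightarrow> gholo U (\<lambda>z. \<Sum>i\<in>I. f i z)"
  by (induction I rule: infinite_finite_induct) (auto intro: gholo_const gholo_add)

lemma gholo_coord: "gholo U (\<lambda>z. z $ i)"
  by (auto simp: gholo_def intro!: continuous_intros holomorphic_intros)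

lemma gholo_cong: "gholo U f \<Longrightarrow> (\<And>z. z \<in> U \<Longrightarrow> f z = g z) \<Longrightarrow> gholo U g"
  unfolding gholo_def
  by (metis (mono_tags, lifting) continuous_on_cong holomorphic_transform mem_Collect_eq)

lemma gholo_imp_continuous_vec:
  assumes "\<And>i. gholo U (\<lambda>z. F z $ i)" shows "continuous_on U F"
proof -
  have "continuous_on U (\<lambda>z. \<chi> i. F z $ i)"
    by (intro continuous_on_vec_lambda gholo_continuous_on assms)
  then show ?thesis by simp
qed

text \<open>Affine maps send complex lines to complex lines, so they respect a notion tested on
  lines. Nonlinear substitutions are replaced later by graphs and contour integrals.\<close>

lemma gholo_compose_affine:
  assumes L: "clinear_map L" and f: "gholo U f" and V: "\<And>z. z \<in> V \<Longrightarrow> b + L z \<in> U"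
  shows "gholo V (\<lambda>z. f (b + L z))"
proof (rule gholoI)
  show "continuous_on V (\<lambda>z. f (b + L z))"
    by (rule continuous_on_compose2[OF gholo_continuous_on[OF f]])
       (use clinear_map_continuous_on[OF L] V in \<open>auto intro!: continuous_intros\<close>)
  fix z v
  have "(\<lambda>s. f ((b + L z) + s *s L v)) holomorphic_on {s. z + s *s v \<in> V}"
    by (rule holomorphic_on_subset[OF gholo_line[OF f]])
       (auto dest!: V simp: clinear_map_add[OF L] clinear_map_smult[OF L] add.assoc)
  then show "(\<lambda>s. f (b + L (z + s *s v))) holomorphic_on {s. z + s *s v \<in> V}"
    by (simp add: clinear_map_add[OF L] clinear_map_smult[OF L] add.assoc)
qed

lemma gholo_compose_linear:
  assumes "clinear_map L" "gholo U f" "\<And>z. z \<in> V \<Longrightarrow> L z \<in> U"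
  shows "gholo V (\<lambda>z. f (L z))"
  using gholo_compose_affine[of L U f V 0] assms by simp

lemma gholo_local:
  assumes "\<And>z. z \<in> U \<Longrightarrow> \<exists>V. open V \<and> z \<in> V \<and> gholo V f"
  shows "gholo U f"
proof (rule gholoI)
  show "continuous_on U f"
    by (metis assms continuous_at_imp_continuous_on continuous_on_eq_continuous_at gholo_continuous_on)
  fix z v
  show "(\<lambda>s. f (z + s *s v)) holomorphic_on {s. z + s *s v \<in> U}"
    unfolding holomorphic_on_def
  proof
    fix s assume "s \<in> {s. z + s *s v \<in> U}"
    then obtain V where V: "open V" "z + s *s v \<in> V" "gholo V f" using assms by blast
    have "open {s. z + s *s v \<in> V}" using V(1) by (rule open_line)
    then show "(\<lambda>s. f (z + s *s v)) field_differentiable at s within {s. z + s *s v \<in> U}"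
      using gholo_line[OF V(3), of z v] V(2)
      by (metis (mono_tags, lifting) field_differentiable_at_within holomorphic_on_imp_differentiable_at mem_Collect_eq)
  qed
qed


section \<open>Parameter integrals and directional derivatives\<close>

text \<open>Leibniz rule. The jointly continuous derivative that it asks for comes for free:
  Cauchy's formula on a small circle writes it as an integral of \<open>h\<close> itself.\<close>

lemma holomorphic_on_integral_param:
  fixes h :: "complex \<Rightarrow> real \<Rightarrow> complex"
  assumes D: "open D" and cont: "continuous_on (D \<times> cbox a b) (\<lambda>(s, t). h s t)"
    and hol: "\<And>t. t \<in> cbox a b \<Longrightarrow> (\<lambda>s. h s t) holomorphic_on D"
  shows "(\<lambda>s. integral (cbox a b) (h s)) holomorphic_on D"
  unfolding holomorphic_on_def
proof
  fix s0 assume "s0 \<in> D"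
  then obtain r where r: "r > 0" "cball s0 r \<subseteq> D" using D open_contains_cball by blast
  have sph: "circlepath s0 r x \<in> cball s0 r" for x
    using r(1) by (simp add: circlepath dist_norm norm_mult)
  \<comment> \<open>The kernel of Cauchy's formula for the first derivative, with the velocity of
    the circle absorbed into it.\<close>
  define k where "k = (\<lambda>s x. (2 * of_real pi * \<i> * r * exp (2 * of_real pi * \<i> * of_real x))
      / (circlepath s0 r x - s)\<^sup>2 :: complex)"
  define fx where "fx = (\<lambda>s t. (1 / (2 * of_real pi * \<i>))
      * integral (cbox 0 1) (\<lambda>x. h (circlepath s0 r x) t * k s x))"
  have der: "((\<lambda>s. h s t) has_field_derivative fx s t) (at s within ball s0 r)"
    if "s \<in> ball s0 r" "t \<in> cbox a b" for s t
  proof -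
    have "continuous_on (cball s0 r) (\<lambda>s. h s t)" "(\<lambda>s. h s t) holomorphic_on ball s0 r"
      using hol[OF that(2)] r(2) ball_subset_cball
      by (meson holomorphic_on_imp_continuous_on holomorphic_on_subset subset_trans)+
    from Cauchy_derivative_integral_circlepath(2)[OF this that(1)]
    have "((\<lambda>s. h s t) has_field_derivative 1 / (2 * of_real pi * \<i>)
        * contour_integral (circlepath s0 r) (\<lambda>u. h u t / (u - s)\<^sup>2)) (at s)" .
    also have "contour_integral (circlepath s0 r) (\<lambda>u. h u t / (u - s)\<^sup>2)
        = integral (cbox 0 1) (\<lambda>x. h (circlepath s0 r x) t * k s x)"
      unfolding contour_integral_integral cbox_interval
      by (rule integral_cong) (simp add: vector_derivative_circlepath k_def mult_ac)
    finally show ?thesis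
      unfolding fx_def by (rule has_field_derivative_at_within)
  qed
  have "continuous_on ((ball s0 r \<times> cbox a b) \<times> cbox 0 1)
      (\<lambda>(p, x). h (circlepath s0 r x) (snd p) * k (fst p) x)"
  proof -
    have ne: "circlepath s0 r x \<noteq> s" if "s \<in> ball s0 r" for s x
      using that r(1) by (auto simp: circlepath dist_norm norm_mult)
    have "continuous_on ((ball s0 r \<times> cbox a b) \<times> cbox 0 1)
      (\<lambda>q. (\<lambda>(s, t). h s t) (circlepath s0 r (snd q), snd (fst q)))"
      by (rule continuous_on_compose2[OF cont])
         (use sph r(2) in \<open>auto simp: circlepath intro!: continuous_intros\<close>)
    moreover have "continuous_on ((ball s0 r \<times> cbox a b) \<times> cbox 0 1) (\<lambda>q. k (fst (fst q)) (snd q))"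
      unfolding k_def using ne by (auto simp: circlepath intro!: continuous_intros)
    ultimately show ?thesis
      unfolding split_beta by (auto intro: continuous_on_mult)
  qed
  from integral_continuous_on_param[OF this]
  have contfx: "continuous_on (ball s0 r \<times> cbox a b) (\<lambda>(s, t). fx s t)"
    unfolding fx_def split_beta by (intro continuous_intros)
  have "(\<lambda>s. integral (cbox a b) (h s)) holomorphic_on ball s0 r"
  proof (rule leibniz_rule_holomorphic[OF _ _ contfx])
    show "((\<lambda>s. h s t) has_field_derivative fx s t) (at s within ball s0 r)"
      if "s \<in> ball s0 r" "t \<in> cbox a b" for s t using that by (rule der)
  next
    fix s assume s: "s \<in> ball s0 r"
    then have "s \<in> D" using r by auto
    then have "continuous_on (cbox a b) (\<lambda>t. (\<lambda>(s, t). h s t) (s, t))"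
      by (intro continuous_on_compose2[OF cont]) (auto intro!: continuous_on_Pair continuous_on_const continuous_on_id)
    then have "continuous_on (cbox a b) (h s)" by simp
    then show "h s integrable_on cbox a b" by (rule integrable_continuous)
  qed (rule convex_ball)
  then show "(\<lambda>s. integral (cbox a b) (h s)) field_differentiable at s0 within D"
    using field_differentiable_at_within[OF holomorphic_on_imp_differentiable_at[of _ "ball s0 r" s0]]
      r(1) by simp
qed

lemma gholo_integral:
  fixes h :: "(complex, 'n::finite) vec \<Rightarrow> real \<Rightarrow> complex"
  assumes U: "open U" and cont: "continuous_on (U \<times> cbox a b) (\<lambda>(z, t). h z t)"
    and hol: "\<And>t. t \<in> cbox a b \<Longrightarrow> gholo U (\<lambda>z. h z t)"
  shows "gholo U (\<lambda>z. integral (cbox a b) (h z))"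
proof (rule gholoI)
  show "continuous_on U (\<lambda>z. integral (cbox a b) (h z))"
    by (rule integral_continuous_on_param[OF cont])
  fix z v
  show "(\<lambda>s. integral (cbox a b) (h (z + s *s v))) holomorphic_on {s. z + s *s v \<in> U}"
  proof (rule holomorphic_on_integral_param)
    show "open {s. z + s *s v \<in> U}" using U by (rule open_line)
    have "continuous_on ({s. z + s *s v \<in> U} \<times> cbox a b)
        (\<lambda>q. (\<lambda>(z, t). h z t) (z + fst q *s v, snd q))"
      by (rule continuous_on_compose2[OF cont]) (auto intro!: continuous_intros)
    then show "continuous_on ({s. z + s *s v \<in> U} \<times> cbox a b) (\<lambda>(s, t). h (z + s *s v) t)"
      by (simp add: split_beta)
  qed (rule gholo_line[OF hol])
qed

definition dir_deriv :: "(complex, 'n::finite) vec \<Rightarrow> ((complex, 'n) vec \<Rightarrow> complex) \<Rightarrow> (complex, 'n) vec \<Rightarrow> complex"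
  where "dir_deriv v f z = deriv (\<lambda>s. f (z + s *s v)) 0"

text \<open>On the line in direction \<open>v\<close>, Cauchy's formula over a circle whose radius
  is uniform near \<open>z0\<close> turns the derivative into a parameter integral of
  \<open>f\<close>.\<close>

lemma gholo_dir_deriv:
  fixes f :: "(complex, 'n::finite) vec \<Rightarrow> complex"
  assumes U: "open U" and f: "gholo U f"
  shows "gholo U (dir_deriv v f)"
proof (rule gholo_local)
  fix z0 assume "z0 \<in> U"
  then obtain d where "d > 0" "ball z0 d \<subseteq> U" using U open_contains_ball by blast
  then obtain e where e: "e > 0" "ball z0 (2 * e) \<subseteq> U" by (intro that[of "d / 2"]) auto
  \<comment> \<open>Makes \<open>s *s v\<close> shorter than \<open>e\<close> for all
    \<open>s\<close> in the closed disc of radius \<open>\<rho>\<close>; the summand 1 covers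
    \<open>v = 0\<close>.\<close>
  define \<rho> where "\<rho> = e / (norm v + 1)"
  have \<rho>: "\<rho> > 0" and \<rho>v: "\<rho> * norm v < e"
    using e(1) norm_ge_zero[of v] by (auto simp: \<rho>_def divide_less_eq add_nonneg_pos distrib_left intro!: divide_pos_pos)
  have inU: "z + s *s v \<in> U" if "z \<in> ball z0 e" "cmod s \<le> \<rho>" for z s
  proof -
    have "cmod s * norm v \<le> \<rho> * norm v" using that(2) by (intro mult_right_mono) auto
    then have "norm (s *s v) < e" using \<rho>v by (simp add: norm_vector_smult)
    then have "dist z0 (z + s *s v) < 2 * e"
      using that(1) norm_triangle_ineq4[of "z0 - z" "s *s v"] by (simp add: dist_norm algebra_simps)
    then show ?thesis using e(2) by auto
  qed
  define k where "k = (\<lambda>x. (2 * of_real pi * \<i> * \<rho> * exp (2 * of_real pi * \<i> * of_real x))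
      / (circlepath 0 \<rho> x)\<^sup>2 :: complex)"
  have circ: "cmod (circlepath 0 \<rho> x) = \<rho>" for x
    using \<rho> by (simp add: circlepath norm_mult)
  have eq: "dir_deriv v f z = 1 / (2 * of_real pi * \<i>)
      * integral (cbox 0 1) (\<lambda>x. f (z + circlepath 0 \<rho> x *s v) * k x)" if z: "z \<in> ball z0 e" for z
  proof -
    have "(\<lambda>s. f (z + s *s v)) holomorphic_on cball 0 \<rho>"
      by (rule holomorphic_on_subset[OF gholo_line[OF f]]) (use inU[OF z] in auto)
    then have "continuous_on (cball 0 \<rho>) (\<lambda>s. f (z + s *s v))"
      "(\<lambda>s. f (z + s *s v)) holomorphic_on ball 0 \<rho>"
      by (meson holomorphic_on_imp_continuous_on holomorphic_on_subset ball_subset_cball)+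
    from Cauchy_derivative_integral_circlepath(2)[OF this, of 0] \<rho>
    have "dir_deriv v f z = 1 / (2 * of_real pi * \<i>)
        * contour_integral (circlepath 0 \<rho>) (\<lambda>u. f (z + u *s v) / (u - 0)\<^sup>2)"
      unfolding dir_deriv_def by (intro DERIV_imp_deriv) simp
    also have "contour_integral (circlepath 0 \<rho>) (\<lambda>u. f (z + u *s v) / (u - 0)\<^sup>2)
        = integral (cbox 0 1) (\<lambda>x. f (z + circlepath 0 \<rho> x *s v) * k x)"
      unfolding contour_integral_integral cbox_interval
      by (rule integral_cong) (simp add: vector_derivative_circlepath k_def mult_ac)
    finally show ?thesis .
  qed
  have "gholo (ball z0 e) (\<lambda>z. integral (cbox 0 1) (\<lambda>x. f (z + circlepath 0 \<rho> x *s v) * k x))"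
  proof (rule gholo_integral)
    have "continuous_on (ball z0 e \<times> cbox 0 1) (\<lambda>q. f (fst q + circlepath 0 \<rho> (snd q) *s v))"
      by (rule continuous_on_compose2[OF gholo_continuous_on[OF f]])
         (use inU circ in \<open>auto simp: circlepath intro!: continuous_intros\<close>)
    moreover have "continuous_on (ball z0 e \<times> cbox 0 1) (\<lambda>q. k (snd q))"
      unfolding k_def using \<rho> by (auto simp: circlepath intro!: continuous_intros)
    ultimately show "continuous_on (ball z0 e \<times> cbox 0 1)
        (\<lambda>(z, x). f (z + circlepath 0 \<rho> x *s v) * k x)"
      unfolding split_beta by (rule continuous_on_mult)
    fix x
    have "gholo (ball z0 e) (\<lambda>z. f (circlepath 0 \<rho> x *s v + z))"
      using inU circ by (intro gholo_compose_affine[OF _ f]) (auto intro!: clinear_mapI simp: add.commute)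
    then show "gholo (ball z0 e) (\<lambda>z. f (z + circlepath 0 \<rho> x *s v) * k x)"
      by (intro gholo_mult gholo_const) (simp add: add.commute)
  qed auto
  then have "gholo (ball z0 e) (dir_deriv v f)"
    by (rule gholo_cong[OF gholo_mult[OF gholo_const[of _ "1 / (2 * of_real pi * \<i>)"]]]) (simp add: eq)
  then show "\<exists>V. open V \<and> z0 \<in> V \<and> gholo V (dir_deriv v f)"
    using e(1) by (intro exI[of _ "ball z0 e"]) auto
qed

lemma has_field_derivative_line:
  fixes f :: "(complex, 'n::finite) vec \<Rightarrow> complex"
  assumes f': "(f has_derivative f') (at (z + s *s v))" "\<And>c v. f' (c *s v) = c * f' v"
  shows "((\<lambda>s. f (z + s *s v)) has_field_derivative f' v) (at s)"
proof -
  have "bounded_linear (\<lambda>s. s *s v)"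
    by (rule bounded_linear_intro[where K = "norm v"])
       (auto simp: vec_eq_iff algebra_simps norm_vector_smult)
  then have "((\<lambda>s. z + s *s v) has_derivative (\<lambda>s. s *s v)) (at s)"
    by (auto intro!: derivative_eq_intros bounded_linear_imp_has_derivative)
  from diff_chain_at[OF this f'(1)]
  have "((\<lambda>s. f (z + s *s v)) has_derivative (\<lambda>s. s * f' v)) (at s)"
    by (simp add: o_def f'(2))
  moreover have "(\<lambda>s. s * f' v) = (*) (f' v)" by (simp add: fun_eq_iff mult.commute)
  ultimately show ?thesis by (simp add: has_field_derivative_def)
qed

lemma complex_differentiable_at_imp_gholo:
  fixes f :: "(complex, 'n::finite) vec \<Rightarrow> complex"
  assumes "\<And>z. z \<in> U \<Longrightarrow> complex_differentiable_at f z"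
  shows "gholo U f"
proof (rule gholoI)
  show "continuous_on U f"
    using assms unfolding complex_differentiable_at_def
    by (meson continuous_at_imp_continuous_on has_derivative_continuous)
  fix z v
  show "(\<lambda>s. f (z + s *s v)) holomorphic_on {s. z + s *s v \<in> U}"
    unfolding holomorphic_on_def
  proof
    fix s assume "s \<in> {s. z + s *s v \<in> U}"
    then obtain f' where f': "(f has_derivative f') (at (z + s *s v))" "\<And>c v. f' (c *s v) = c * f' v"
      using assms unfolding complex_differentiable_at_def by blast
    from has_field_derivative_line[OF f']
    have "((\<lambda>s. f (z + s *s v)) has_field_derivative f' v) (at s)" .
    then show "(\<lambda>s. f (z + s *s v)) field_differentiable at s within {s. z + s *s v \<in> U}"
      unfolding field_differentiable_def by (blast intro: has_field_derivative_at_within)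
  qed
qed

lemma deriv_axis_line: "deriv (\<lambda>s. f (z + axis i s)) t = dir_deriv (axis i 1) f (z + axis i t)"
  for f :: "(complex, 'n::finite) vec \<Rightarrow> complex"
proof -
  have "axis i (t + s) = axis i t + s *s (axis i 1 :: (complex, 'n) vec)" for s
    by (simp add: vec_eq_iff axis_def)
  then have "(\<lambda>s. f (z + axis i s)) \<circ> (\<lambda>s. t + s) = (\<lambda>s. f (z + axis i t + s *s axis i 1))"
    by (simp add: fun_eq_iff add.assoc)
  then show ?thesis
    by (simp only: dir_deriv_def deriv_shift_0[of "\<lambda>s. f (z + axis i s)" t])
qed

section \<open>Symmetric functions of the roots of a holomorphic function\<close>

text \<open>The coefficient of index n is the n-th elementary symmetric function of the values
  \<open>a t\<close>, each repeated \<open>m t\<close> times. Power series are used instead of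
  polynomials because 1 + b X becomes invertible, so that logarithmic derivatives exist.\<close>

definition root_fps :: "'t set \<Rightarrow> ('t \<Rightarrow> nat) \<Rightarrow> ('t \<Rightarrow> complex) \<Rightarrow> complex fps" where
  "root_fps T m a = (\<Prod>t\<in>T. (1 + fps_const (a t) * fps_X) ^ m t)"

lemma root_fps_nth_0: "fps_nth (root_fps T m a) 0 = 1"
  unfolding root_fps_def
  by (induction T rule: infinite_finite_induct) (simp_all add: fps_power_zeroth)

text \<open>Compare coefficients in E' = E * L, where L is the logarithmic derivative of E =
  \<open>root_fps T m a\<close>. Each factor 1 + b X contributes b / (1 + b X), whose expansion is
  \<open>Q b\<close>.\<close>

lemma newton_identity:
  "of_nat (Suc n) * fps_nth (root_fps T m a) (Suc n)
    = (\<Sum>i\<le>n. fps_nth (root_fps T m a) i * ((-1) ^ (n - i) * (\<Sum>t\<in>T. of_nat (m t) * a t ^ Suc (n - i))))"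
proof -
  define Q :: "complex \<Rightarrow> complex fps" where "Q = (\<lambda>a. Abs_fps (\<lambda>i. (-1) ^ i * a ^ Suc i))"
  have mult: "fps_deriv (E * F) = (E * F) * (P + R)"
    if "fps_deriv E = E * P" "fps_deriv F = F * R" for E F P R :: "complex fps"
    using that by (simp add: algebra_simps)
  have lin: "fps_deriv (1 + fps_const b * fps_X) = (1 + fps_const b * fps_X) * Q b" for b
  proof (rule fps_ext)
    fix n
    show "fps_nth (fps_deriv (1 + fps_const b * fps_X)) n = fps_nth ((1 + fps_const b * fps_X) * Q b) n"
      by (cases n) (auto simp: Q_def distrib_right mult.assoc)
  qed
  have pow: "fps_deriv ((1 + fps_const b * fps_X) ^ k) = (1 + fps_const b * fps_X) ^ k * (of_nat k * Q b)" for b k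
  proof (induction k)
    case (Suc k)
    from mult[OF lin[of b] Suc] show ?case by (simp add: algebra_simps)
  qed simp
  have "fps_deriv (root_fps T m a) = root_fps T m a * (\<Sum>t\<in>T. of_nat (m t) * Q (a t))"
    unfolding root_fps_def
  proof (induction T rule: infinite_finite_induct)
    case (insert t T)
    from mult[OF pow[of "a t" "m t"] insert.IH] show ?case
      using insert.hyps by simp
  qed simp_all
  then have "fps_nth (fps_deriv (root_fps T m a)) n
      = fps_nth (root_fps T m a * (\<Sum>t\<in>T. of_nat (m t) * Q (a t))) n" by simp
  moreover have "fps_nth (of_nat k * Q b) j = of_nat k * ((-1) ^ j * b ^ Suc j)" for k b j
    by (simp add: Q_def flip: fps_of_nat)
  then have "fps_nth (\<Sum>t\<in>T. of_nat (m t) * Q (a t)) j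
      = (-1) ^ j * (\<Sum>t\<in>T. of_nat (m t) * a t ^ Suc j)" for j
    by (simp only: fps_sum_nth) (simp add: sum_distrib_left mult_ac del: power_Suc)
  ultimately show ?thesis
    by (simp only: fps_mult_nth atLeast0AtMost fps_deriv_nth Suc_eq_plus1)
qed

text \<open>Degree bounds add and the coefficients at the bounds multiply. In \<open>D E N c\<close>
  the number \<open>N\<close> is only a bound, so values \<open>a t = 0\<close> need no separate
  treatment.\<close>

lemma root_fps_top:
  "(\<forall>n > (\<Sum>t\<in>T. m t). fps_nth (root_fps T m a) n = 0) \<and>
   fps_nth (root_fps T m a) (\<Sum>t\<in>T. m t) = (\<Prod>t\<in>T. a t ^ m t)"
proof -
  define D where "D = (\<lambda>(E :: complex fps) N c. (\<forall>n>N. fps_nth E n = 0) \<and> fps_nth E N = c)"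
  have mult: "D (E * F) (M + N) (c * d)" if E: "D E M c" and F: "D F N d" for E F M N c d
  proof -
    have z: "fps_nth E i * fps_nth F (n - i) = 0" if "n \<ge> M + N" "i \<noteq> M \<or> n > M + N" for i n
      using E F that unfolding D_def by (cases "i > M") (auto simp: not_less)
    have "fps_nth (E * F) n = 0" if "n > M + N" for n
      unfolding fps_mult_nth using that by (intro sum.neutral ballI z) auto
    moreover have "fps_nth (E * F) (M + N) = (\<Sum>i\<in>{M}. fps_nth E i * fps_nth F (M + N - i))"
      unfolding fps_mult_nth by (rule sum.mono_neutral_right) (use z[of "M + N"] in auto)
    ultimately show ?thesis using E F by (simp add: D_def)
  qed
  have lin: "D (1 + fps_const b * fps_X) 1 b" for b
    by (auto simp: D_def fps_X_def)
  have pow: "D ((1 + fps_const b * fps_X) ^ k) k (b ^ k)" for b k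
  proof (induction k)
    case (Suc k)
    from mult[OF lin[of b] this] show ?case by simp
  qed (simp add: D_def)
  have "D (root_fps T m a) (\<Sum>t\<in>T. m t) (\<Prod>t\<in>T. a t ^ m t)"
    unfolding root_fps_def
  proof (induction T rule: infinite_finite_induct)
    case (insert t T)
    from mult[OF pow[of "a t" "m t"] insert.IH] show ?case
      using insert.hyps by simp
  qed (simp_all add: D_def)
  then show ?thesis by (simp add: D_def)
qed

section \<open>Zeros on a disc that moves with a parameter\<close>

text \<open>The situation of Weierstrass preparation: no zero crosses the circle of radius
  \<open>\<rho>\<close> in direction \<open>i\<close> while the centre \<open>z\<close> moves in a
  ball. The parameter is a full vector, not one with the coordinate \<open>i\<close> removed, which
  avoids a second index type. The bound \<open>\<rho> + d \<le> r\<close> keeps the closed discs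
  inside the domain.\<close>

locale root_family =
  fixes g :: "(complex, 'n::finite) vec \<Rightarrow> complex" and i :: 'n and r \<rho> d :: real
  assumes g: "gholo (ball 0 r) g" and \<rho>: "\<rho> > 0" and d: "d > 0" and le: "\<rho> + d \<le> r"
    and circle: "\<And>z t. z \<in> ball 0 d \<Longrightarrow> cmod t = \<rho> \<Longrightarrow> g (z + axis i t) \<noteq> 0"
begin

definition roots :: "(complex, 'n) vec \<Rightarrow> complex set" where
  "roots z = {t. cmod t < \<rho> \<and> g (z + axis i t) = 0}"

text \<open>\<open>zorder\<close> is integer valued; at the points of \<open>roots z\<close> it is
  positive, so \<open>nat\<close> loses nothing there.\<close>

definition mult :: "(complex, 'n) vec \<Rightarrow> complex \<Rightarrow> nat" where
  "mult z t = nat (zorder (\<lambda>s. g (z + axis i s)) t)"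

definition root_sum :: "((complex, 'n) vec \<Rightarrow> complex) \<Rightarrow> (complex, 'n) vec \<Rightarrow> complex" where
  "root_sum \<phi> z = (\<Sum>t\<in>roots z. of_nat (mult z t) * \<phi> (z + axis i t))"

definition root_prod :: "((complex, 'n) vec \<Rightarrow> complex) \<Rightarrow> (complex, 'n) vec \<Rightarrow> complex" where
  "root_prod \<phi> z = (\<Prod>t\<in>roots z. \<phi> (z + axis i t) ^ mult z t)"

lemma in_ball:
  assumes "norm z + cmod t < r" shows "z + axis i t \<in> ball 0 r"
  using assms norm_triangle_ineq[of z "axis i t"] by (simp add: norm_axis)

lemma in_ball':
  assumes "z \<in> ball 0 d" "cmod t \<le> \<rho>" shows "z + axis i t \<in> ball 0 r"
  using assms le by (intro in_ball) simp

lemma slice_holo: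
  assumes "gholo (ball 0 r) f"
  shows "(\<lambda>t. f (z + axis i t)) holomorphic_on ball 0 (r - norm z)"
  by (rule holomorphic_on_subset[OF gholo_axis[OF assms]]) (use in_ball[of z] in auto)

text \<open>A constant slice would have the same value at the zero and on the circle. This is what
  isolates zeros and makes their orders positive.\<close>

lemma not_const:
  assumes z: "z \<in> ball 0 d" and t0: "t0 \<in> ball 0 (r - norm z)" and g0: "g (z + axis i t0) = 0"
  shows "\<not> (\<lambda>t. g (z + axis i t)) constant_on ball 0 (r - norm z)"
proof
  assume "(\<lambda>t. g (z + axis i t)) constant_on ball 0 (r - norm z)"
  then have "g (z + axis i (of_real \<rho>)) = g (z + axis i t0)"
    using t0 z \<rho> le by (auto simp: constant_on_def)
  then show False using circle[OF z, of "of_real \<rho>"] g0 \<rho> by simp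
qed

lemma finite_zeros:
  assumes z: "z \<in> ball 0 d" and s: "s < r - norm z"
  shows "finite {t \<in> cball 0 s. g (z + axis i t) = 0}"
proof (cases "\<exists>t0 \<in> cball 0 s. g (z + axis i t0) = 0")
  case True
  then obtain t0 where "t0 \<in> ball 0 (r - norm z)" "g (z + axis i t0) = 0" using s by force
  from not_const[OF z this] show ?thesis
    by (intro holomorphic_compact_finite_zeros[OF slice_holo[OF g]]) (use s in auto)
qed (auto intro: finite_subset[of _ "{}"])

lemma finite_roots: "z \<in> ball 0 d \<Longrightarrow> finite (roots z)"
  by (rule finite_subset[OF _ finite_zeros[of z \<rho>]]) (use le in \<open>auto simp: roots_def\<close>)

lemma zorder_pos:
  assumes z: "z \<in> ball 0 d" and t: "t \<in> roots z"
  shows "zorder (\<lambda>s. g (z + axis i s)) t > 0"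
proof -
  have *: "t \<in> ball 0 (r - norm z)" "g (z + axis i t) = 0"
    using t z le by (auto simp: roots_def)
  then show ?thesis
    using zorder_exist_zero[OF slice_holo[OF g, of z] open_ball _ *(1)] not_const[OF z *]
    by (auto simp: constant_on_def)
qed

lemma mult_pos: "z \<in> ball 0 d \<Longrightarrow> t \<in> roots z \<Longrightarrow> mult z t > 0"
  using zorder_pos by (simp add: mult_def)

text \<open>The argument principle weighted by \<open>\<phi>\<close>: the winding number is 1 at the
  zeros inside the circle and 0 at those outside.\<close>

lemma root_sum_eq:
  assumes z: "z \<in> ball 0 d" and \<phi>: "gholo (ball 0 r) \<phi>"
  shows "contour_integral (circlepath 0 \<rho>)
      (\<lambda>t. dir_deriv (axis i 1) g (z + axis i t) * \<phi> (z + axis i t) / g (z + axis i t))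
    = 2 * pi * \<i> * root_sum \<phi> z"
proof -
  \<comment> \<open>A slightly larger disc, so that the circle lies in an open set on which the
    slice has only finitely many zeros.\<close>
  obtain s where s: "\<rho> < s" "s < r - norm z"
    using dense[of \<rho> "r - norm z"] z le by auto
  define f where "f = (\<lambda>t. g (z + axis i t))"
  have der: "deriv f t = dir_deriv (axis i 1) g (z + axis i t)" for t
    unfolding f_def by (rule deriv_axis_line)
  define pz where "pz = {w \<in> ball 0 s. f w = 0 \<or> w \<in> {}}"
  have fin: "finite pz"
    by (rule finite_subset[OF _ finite_zeros[OF z s(2)]]) (auto simp: pz_def f_def)
  have sub: "ball 0 s \<subseteq> ball (0::complex) (r - norm z)" using s by auto
  have out: "winding_number (circlepath 0 \<rho>) w = 0" if "cmod w > \<rho>" for w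
    by (rule winding_number_zero_outside[of _ "cball 0 \<rho>"]) (use that \<rho> in auto)
  have "contour_integral (circlepath 0 \<rho>) (\<lambda>t. deriv f t * \<phi> (z + axis i t) / f t)
      = 2 * pi * \<i> * (\<Sum>p\<in>pz. winding_number (circlepath 0 \<rho>) p * \<phi> (z + axis i p) * zorder f p)"
    unfolding pz_def
  proof (rule argument_principle)
    show "f holomorphic_on ball 0 s - {}" "(\<lambda>t. \<phi> (z + axis i t)) holomorphic_on ball 0 s"
      unfolding f_def using holomorphic_on_subset[OF slice_holo[OF g] sub]
        holomorphic_on_subset[OF slice_holo[OF \<phi>] sub] by auto
    show "path_image (circlepath 0 \<rho>) \<subseteq> ball 0 s - {w \<in> ball 0 s. f w = 0 \<or> w \<in> {}}"
      using circle[OF z] s \<rho> by (auto simp: f_def path_image_circlepath)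
    show "\<forall>w. w \<notin> ball 0 s \<longrightarrow> winding_number (circlepath 0 \<rho>) w = 0"
      using out s by auto
    show "finite {w \<in> ball 0 s. f w = 0 \<or> w \<in> {}}" using fin by (simp add: pz_def)
  qed auto
  also have "(\<Sum>p\<in>pz. winding_number (circlepath 0 \<rho>) p * \<phi> (z + axis i p) * zorder f p)
      = (\<Sum>p\<in>roots z. winding_number (circlepath 0 \<rho>) p * \<phi> (z + axis i p) * zorder f p)"
  proof (rule sum.mono_neutral_right[OF fin])
    show "roots z \<subseteq> pz" using s by (auto simp: roots_def pz_def f_def)
    show "\<forall>p\<in>pz - roots z. winding_number (circlepath 0 \<rho>) p * \<phi> (z + axis i p) * zorder f p = 0"
    proof
      fix p assume "p \<in> pz - roots z"
      then have "cmod p > \<rho>"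
        using circle[OF z, of p] by (force simp: pz_def roots_def f_def not_less)
      then show "winding_number (circlepath 0 \<rho>) p * \<phi> (z + axis i p) * zorder f p = 0" using out by simp
    qed
  qed
  also have "\<dots> = root_sum \<phi> z"
    unfolding root_sum_def
  proof (rule sum.cong[OF refl])
    fix p assume p: "p \<in> roots z"
    have "winding_number (circlepath 0 \<rho>) p = 1"
      using p by (intro winding_number_circlepath) (auto simp: roots_def)
    then show "winding_number (circlepath 0 \<rho>) p * \<phi> (z + axis i p) * zorder f p
        = of_nat (mult z p) * \<phi> (z + axis i p)"
      using zorder_pos[OF z p] by (simp add: mult_def f_def of_nat_nat)
  qed
  finally show ?thesis by (simp only: der) (simp add: f_def)
qed

text \<open>The contour integral runs over a fixed circle, and its integrand is holomorphic in
  \<open>z\<close> because the moving circle stays in \<open>W\<close>, away from the zeros of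
  \<open>g\<close>.\<close>

lemma gholo_root_sum:
  assumes \<phi>: "gholo (ball 0 r) \<phi>"
  shows "gholo (ball 0 d) (root_sum \<phi>)"
proof -
  define k where "k = (\<lambda>w. dir_deriv (axis i 1) g w * \<phi> w / g w)"
  define v where "v = (\<lambda>x. 2 * of_real pi * \<i> * \<rho> * exp (2 * of_real pi * \<i> * of_real x) :: complex)"
  have circ: "cmod (circlepath 0 \<rho> x) = \<rho>" for x
    using \<rho> by (simp add: circlepath norm_mult)
  define W where "W = ball 0 r \<inter> {w. g w \<noteq> 0}"
  have inW: "z + axis i (circlepath 0 \<rho> x) \<in> W" if "z \<in> ball 0 d" for z x
    using in_ball'[OF that, of "circlepath 0 \<rho> x"] circle[OF that circ] circ[of x] by (simp add: W_def)
  have k: "gholo W k"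
    unfolding k_def
    using gholo_subset[OF gholo_dir_deriv[OF open_ball g], of W]
      gholo_subset[OF g, of W] gholo_subset[OF \<phi>, of W]
    by (intro gholo_divide gholo_mult) (auto simp: W_def)
  have "gholo (ball 0 d) (\<lambda>z. integral (cbox 0 1) (\<lambda>x. k (z + axis i (circlepath 0 \<rho> x)) * v x))"
  proof (rule gholo_integral)
    have "continuous_on (ball 0 d \<times> cbox 0 1) (\<lambda>q. k (fst q + axis i (circlepath 0 \<rho> (snd q))))"
      by (rule continuous_on_compose2[OF gholo_continuous_on[OF k]])
         (use inW in \<open>auto simp: circlepath intro!: continuous_intros\<close>)
    moreover have "continuous_on (ball 0 d \<times> cbox 0 1) (\<lambda>q. v (snd q))"
      unfolding v_def by (intro continuous_intros)
    ultimately show "continuous_on (ball 0 d \<times> cbox 0 1)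
        (\<lambda>(z, x). k (z + axis i (circlepath 0 \<rho> x)) * v x)"
      unfolding split_beta by (rule continuous_on_mult)
    fix x
    have "gholo (ball 0 d) (\<lambda>z. k (axis i (circlepath 0 \<rho> x) + z))"
      using inW by (intro gholo_compose_affine[OF _ k]) (auto intro!: clinear_mapI simp: add.commute)
    then show "gholo (ball 0 d) (\<lambda>z. k (z + axis i (circlepath 0 \<rho> x)) * v x)"
      by (intro gholo_mult gholo_const) (simp add: add.commute)
  qed auto
  then show ?thesis
  proof (rule gholo_cong[OF gholo_mult[OF gholo_const[of _ "1 / (2 * pi * \<i>)"]]])
    fix z :: "(complex, 'n) vec" assume z: "z \<in> ball 0 d"
    have "2 * pi * \<i> * root_sum \<phi> z
        = integral (cbox 0 1) (\<lambda>x. k (z + axis i (circlepath 0 \<rho> x)) * v x)"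
      unfolding root_sum_eq[OF z \<phi>, symmetric] contour_integral_integral cbox_interval
      by (rule integral_cong) (simp add: vector_derivative_circlepath k_def v_def)
    from this[symmetric] show "1 / (2 * pi * \<i>) * integral (cbox 0 1) (\<lambda>x. k (z + axis i (circlepath 0 \<rho> x)) * v x) = root_sum \<phi> z"
      by (simp add: field_simps)
  qed
qed

text \<open>With weight 1 the root sum counts zeros: a continuous function with integer values on a
  connected ball.\<close>

lemma mult_sum_const: "\<exists>N. \<forall>z\<in>ball 0 d. (\<Sum>t\<in>roots z. mult z t) = N"
proof -
  define M where "M = (\<lambda>z. \<Sum>t\<in>roots z. mult z t)"
  have eq: "root_sum (\<lambda>_. 1) z = of_nat (M z)" for z
    by (simp add: root_sum_def M_def)
  have "root_sum (\<lambda>_. 1) constant_on ball 0 d"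
  proof (rule continuous_discrete_range_constant)
    show "continuous_on (ball 0 d) (root_sum (\<lambda>_. 1))"
      by (rule gholo_continuous_on[OF gholo_root_sum[OF gholo_const]])
    fix x
    show "\<exists>e>0. \<forall>y. y \<in> ball 0 d \<and> root_sum (\<lambda>_. 1) y \<noteq> root_sum (\<lambda>_. 1) x \<longrightarrow>
        e \<le> norm (root_sum (\<lambda>_. 1) y - root_sum (\<lambda>_. 1) x)"
    proof (intro exI[of _ 1] conjI allI impI)
      fix y assume "y \<in> ball 0 d \<and> root_sum (\<lambda>_. 1) y \<noteq> root_sum (\<lambda>_. 1) x"
      then have "root_sum (\<lambda>_. 1) y - root_sum (\<lambda>_. 1) x
          = of_int (int (M y) - int (M x))" "int (M y) - int (M x) \<noteq> 0"
        by (simp_all add: eq)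
      then show "1 \<le> norm (root_sum (\<lambda>_. 1) y - root_sum (\<lambda>_. 1) x)"
        by (simp only: norm_of_int)
    qed auto
  qed auto
  then obtain c where c: "\<And>z. z \<in> ball 0 d \<Longrightarrow> complex_of_nat (M z) = c"
    unfolding constant_on_def eq by blast
  have "0 \<in> ball (0::(complex, 'n) vec) d" using d by simp
  then show ?thesis
    using c by (intro exI[of _ "M 0"]) (metis M_def of_nat_eq_iff)
qed

text \<open>The product is the last elementary symmetric function of the values of \<open>\<phi>\<close> at the roots, and by
  Newton's identities a polynomial in their power sums, which are contour integrals.\<close>

lemma gholo_root_prod:
  assumes \<phi>: "gholo (ball 0 r) \<phi>"
  shows "gholo (ball 0 d) (root_prod \<phi>)"
proof -
  define e where "e = (\<lambda>n z. fps_nth (root_fps (roots z) (mult z) (\<lambda>t. \<phi> (z + axis i t))) n)"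
  have e: "gholo (ball 0 d) (e n)" for n
  proof (induction n rule: less_induct)
    case (less n)
    show ?case
    proof (cases n)
      case 0
      then show ?thesis by (simp add: e_def root_fps_nth_0 gholo_const)
    next
      case (Suc k)
      have "gholo (ball 0 d) (\<lambda>z. 1 / of_nat (Suc k)
          * (\<Sum>j\<le>k. e j z * ((-1) ^ (k - j) * root_sum (\<lambda>w. \<phi> w ^ Suc (k - j)) z)))"
        by (intro gholo_mult gholo_const gholo_sum gholo_root_sum gholo_power \<phi> less.IH) (auto simp: Suc)
      then show ?thesis
      proof (rule gholo_cong)
        fix z
        have "of_nat (Suc k) * e (Suc k) z
            = (\<Sum>j\<le>k. e j z * ((-1) ^ (k - j) * root_sum (\<lambda>w. \<phi> w ^ Suc (k - j)) z))"
          unfolding e_def newton_identity root_sum_def by simp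
        from this[symmetric] show "1 / of_nat (Suc k)
            * (\<Sum>j\<le>k. e j z * ((-1) ^ (k - j) * root_sum (\<lambda>w. \<phi> w ^ Suc (k - j)) z)) = e n z"
          unfolding Suc by (simp only:) (simp del: of_nat_Suc)
      qed
    qed
  qed
  \<comment> \<open>One coefficient index must serve for all \<open>z\<close>; the product sits at
    the number of zeros, which is constant.\<close>
  obtain N where N: "\<And>z. z \<in> ball 0 d \<Longrightarrow> (\<Sum>t\<in>roots z. mult z t) = N"
    using mult_sum_const by blast
  show ?thesis
  proof (rule gholo_cong[OF e[of N]])
    fix z :: "(complex, 'n) vec" assume "z \<in> ball 0 d"
    from N[OF this, symmetric] show "e N z = root_prod \<phi> z"
      by (simp only: e_def root_prod_def root_fps_top)
  qed
qed

text \<open>Positivity of the multiplicities matters: an exponent 0 would turn a vanishing factor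
  into 1.\<close>

lemma root_prod_eq_0_iff:
  assumes "z \<in> ball 0 d"
  shows "root_prod \<phi> z = 0 \<longleftrightarrow> (\<exists>t\<in>roots z. \<phi> (z + axis i t) = 0)"
  using finite_roots[OF assms] mult_pos[OF assms] by (auto simp: root_prod_def)

end

section \<open>Projections of analytic sets\<close>

text \<open>\<open>X\<close> is the common zero set of all holomorphic functions vanishing on it. Working with the full
  ideal avoids finite generation, hence Noetherianity of the ring of germs.\<close>

definition analytic_in :: "real \<Rightarrow> (complex, 'n::finite) vec set \<Rightarrow> bool" where
  "analytic_in r X \<longleftrightarrow>
     (\<forall>z\<in>ball 0 r. z \<notin> X \<longrightarrow> (\<exists>f. gholo (ball 0 r) f \<and> (\<forall>x\<in>X \<inter> ball 0 r. f x = 0) \<and> f z \<noteq> 0))"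

lemma analytic_in_mono:
  assumes "analytic_in r X" "s \<le> r" shows "analytic_in s X"
  unfolding analytic_in_def
proof (intro ballI impI)
  fix z assume "z \<in> ball 0 s" "z \<notin> X"
  moreover have sub: "ball 0 s \<subseteq> ball (0 :: (complex, 'a) vec) r" using assms(2) by auto
  ultimately obtain f where "gholo (ball 0 r) f" "\<forall>x\<in>X \<inter> ball 0 r. f x = 0" "f z \<noteq> 0"
    using assms(1) unfolding analytic_in_def by blast
  with sub show "\<exists>f. gholo (ball 0 s) f \<and> (\<forall>x\<in>X \<inter> ball 0 s. f x = 0) \<and> f z \<noteq> 0"
    by (blast intro: gholo_subset)
qed

text \<open>A generic combination of functions that are nonzero at single points is nonzero at all
  of them, since the field is infinite.\<close>

lemma simultaneously_nonzero:
  fixes V :: "('a \<Rightarrow> 'b::field_char_0) set"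
  assumes "finite T" and V: "\<And>f g c. f \<in> V \<Longrightarrow> g \<in> V \<Longrightarrow> (\<lambda>x. f x + c * g x) \<in> V" and "V \<noteq> {}"
    and "\<And>t. t \<in> T \<Longrightarrow> \<exists>f\<in>V. f t \<noteq> 0"
  shows "\<exists>f\<in>V. \<forall>t\<in>T. f t \<noteq> 0"
  using assms(1,4)
proof (induction T rule: finite_induct)
  case empty
  then show ?case using \<open>V \<noteq> {}\<close> by auto
next
  case (insert t T)
  obtain f where f: "f \<in> V" "\<forall>t\<in>T. f t \<noteq> 0" using insert by blast
  obtain g where g: "g \<in> V" "g t \<noteq> 0" using insert.prems by blast
  \<comment> \<open>Each point with \<open>g s \<noteq> 0\<close> forbids one value. If
    \<open>g s = 0\<close>, then \<open>s\<close> lies in \<open>T\<close> and \<open>f s\<close> is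
    already nonzero; the quotient is then 0 by convention and does no harm.\<close>
  obtain c :: 'b where c: "c \<notin> insert 0 ((\<lambda>s. - f s / g s) ` insert t T)"
    using ex_new_if_finite[OF infinite_UNIV_char_0] insert.hyps by (meson finite.insertI finite_imageI)
  have "f s + c * g s \<noteq> 0" if "s \<in> insert t T" for s
  proof
    assume eq: "f s + c * g s = 0"
    have "g s \<noteq> 0"
    proof
      assume "g s = 0"
      with eq f(2) g(2) that show False by auto
    qed
    with eq have "c = - f s / g s" by (simp add: field_simps eq_neg_iff_add_eq_0)
    with c that show False by auto
  qed
  then show ?case using V[OF f(1) g(1), of c] by (intro bexI[of _ "\<lambda>x. f x + c * g x"]) auto
qed

text \<open>The circle over the origin is compact, so nonvanishing persists in a tube around
  it.\<close>

lemma root_family_if_circle: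
  assumes g: "gholo (ball 0 r) g" and \<rho>: "0 < \<rho>" "\<rho> < r"
    and circle: "\<And>t. cmod t = \<rho> \<Longrightarrow> g (axis i t) \<noteq> 0"
  obtains d where "root_family g i r \<rho> d"
proof -
  define K where "K = (\<lambda>t. axis i t :: (complex, 'a) vec) ` sphere 0 \<rho>"
  define V where "V = ball 0 r \<inter> {w. g w \<noteq> 0}"
  have "compact K" unfolding K_def by (intro compact_continuous_image continuous_intros) auto
  moreover have "open V"
    using continuous_open_preimage[OF gholo_continuous_on[OF g] open_ball, of "- {0}"]
    by (simp add: V_def vimage_def Int_def open_Compl)
  moreover have "K \<subseteq> V" using circle \<rho> by (auto simp: K_def V_def norm_axis)
  ultimately obtain e where e: "e > 0" "(\<Union>x\<in>K. ball x e) \<subseteq> V"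
    by (rule compact_subset_open_imp_ball_epsilon_subset)
  have "root_family g i r \<rho> (min e (r - \<rho>))"
  proof
    fix z t assume "z \<in> ball (0 :: (complex, 'a) vec) (min e (r - \<rho>))" "cmod t = \<rho>"
    then have "z + axis i t \<in> ball (axis i t) e" "axis i t \<in> K"
      by (auto simp: dist_norm K_def)
    then have "z + axis i t \<in> V" using e(2) by blast
    then show "g (z + axis i t) \<noteq> 0" by (simp add: V_def)
  qed (use g \<rho> e in auto)
  then show ?thesis by (rule that)
qed

text \<open>Some function vanishing on \<open>X\<close> is nonzero at a point of the axis. Its zeros
  on the axis are isolated, so a small circle passes between them.\<close>

lemma root_family_if_analytic_in:
  assumes X: "analytic_in r X" and r: "r > 0"
    and iso: "\<And>t. 0 < cmod t \<Longrightarrow> cmod t < r \<Longrightarrow> axis i t \<notin> X"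
  obtains g \<rho> d where "root_family g i r \<rho> d" "\<And>x. x \<in> X \<Longrightarrow> x \<in> ball 0 r \<Longrightarrow> g x = 0"
proof -
  define t0 where "t0 = complex_of_real (r / 2)"
  have t0: "axis i t0 \<notin> X" "axis i t0 \<in> ball 0 r"
    using iso[of t0] r by (simp_all add: t0_def norm_axis norm_divide)
  then obtain g where g: "gholo (ball 0 r) g" "\<forall>x\<in>X \<inter> ball 0 r. g x = 0" "g (axis i t0) \<noteq> 0"
    using X unfolding analytic_in_def by blast
  define u where "u = (\<lambda>t. g (axis i t))"
  have hol: "u holomorphic_on ball 0 r"
    using gholo_axis[OF g(1), of 0 i] by (simp add: u_def norm_axis ball_def)
  have fin: "finite {t \<in> cball 0 (r / 2). u t = 0}"
  proof (cases "u constant_on ball 0 r")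
    \<comment> \<open>This case does occur, for instance if \<open>X\<close> is empty; the constant
      is then nonzero.\<close>
    case True
    then have "u t \<noteq> 0" if "t \<in> cball 0 (r / 2)" for t
      using g(3) that t0(2) r by (auto simp: constant_on_def u_def norm_axis)
    then show ?thesis by (auto intro: finite_subset[of _ "{}"])
  next
    case False
    then show ?thesis by (intro holomorphic_compact_finite_zeros[OF hol]) (use r in auto)
  qed
  \<comment> \<open>Finitely many zeros have finitely many moduli, so some radius avoids all of
    them.\<close>
  have "infinite ({0<..<r / 2} - cmod ` {t \<in> cball 0 (r / 2). u t = 0})"
    using fin r by (intro Diff_infinite_finite) auto
  then have "{0<..<r / 2} - cmod ` {t \<in> cball 0 (r / 2). u t = 0} \<noteq> {}" by (metis finite.emptyI)
  then obtain \<rho> where "\<rho> \<in> {0<..<r / 2} - cmod ` {t \<in> cball 0 (r / 2). u t = 0}"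
    by (metis all_not_in_conv)
  then have \<rho>: "0 < \<rho>" "\<rho> < r / 2" "\<rho> \<notin> cmod ` {t \<in> cball 0 (r / 2). u t = 0}"
    by auto
  obtain d where "root_family g i r \<rho> d"
    by (rule root_family_if_circle[OF g(1) \<rho>(1)]) (use \<rho> in \<open>auto simp: u_def image_iff\<close>)
  then show ?thesis using g(2) by (intro that[of g \<rho> d]) auto
qed

text \<open>For a point \<open>z\<close> outside the projection, finitely many zeros of
  \<open>g\<close> lie over \<open>z\<close> and none is in \<open>X\<close>, so one
  \<open>f\<close> vanishing on \<open>X\<close> is nonzero at all of them. Its norm
  \<open>root_prod f\<close> separates \<open>z\<close> from the projection: a point of
  \<open>X\<close> over \<open>x\<close> is among the zeros of \<open>g\<close>, so the norm
  vanishes at \<open>x\<close>.\<close>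

lemma analytic_in_project_axis:
  assumes X: "analytic_in r X" and r: "r > 0"
    and iso: "\<And>t. 0 < cmod t \<Longrightarrow> cmod t < r \<Longrightarrow> axis i t \<notin> X"
  obtains \<rho> d where "\<rho> > 0" "d > 0" "\<rho> + d \<le> r"
    "analytic_in d {z. \<exists>t. cmod t < \<rho> \<and> z + axis i t \<in> X}"
proof -
  obtain g \<rho> d where rf: "root_family g i r \<rho> d" and gX: "\<And>x. x \<in> X \<Longrightarrow> x \<in> ball 0 r \<Longrightarrow> g x = 0"
    using root_family_if_analytic_in[OF X r iso] by metis
  interpret root_family g i r \<rho> d by (rule rf)
  have "analytic_in d {z. \<exists>t. cmod t < \<rho> \<and> z + axis i t \<in> X}"
    unfolding analytic_in_def
  proof (intro ballI impI)
    fix z assume z: "z \<in> ball 0 d" and nz: "z \<notin> {z. \<exists>t. cmod t < \<rho> \<and> z + axis i t \<in> X}"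
    define V where "V = {f. gholo (ball 0 r) f \<and> (\<forall>x\<in>X \<inter> ball 0 r. f x = 0)}"
    have "\<exists>f\<in>V. \<forall>w\<in>(\<lambda>t. z + axis i t) ` roots z. f w \<noteq> 0"
    proof (rule simultaneously_nonzero)
      fix w assume "w \<in> (\<lambda>t. z + axis i t) ` roots z"
      then have "w \<in> ball 0 r" "w \<notin> X"
        using nz in_ball'[OF z] by (auto simp: roots_def)
      then show "\<exists>f\<in>V. f w \<noteq> 0" using X unfolding analytic_in_def V_def by blast
    next
      show "V \<noteq> {}" using gholo_const[of "ball 0 r" 0] by (auto simp: V_def)
    qed (auto simp: V_def finite_roots[OF z] intro!: gholo_add gholo_mult gholo_const)
    then obtain f where f: "f \<in> V" "\<forall>t\<in>roots z. f (z + axis i t) \<noteq> 0" by blast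
    show "\<exists>f. gholo (ball 0 d) f \<and>
        (\<forall>x\<in>{z. \<exists>t. cmod t < \<rho> \<and> z + axis i t \<in> X} \<inter> ball 0 d. f x = 0) \<and> f z \<noteq> 0"
    proof (intro exI[of _ "root_prod f"] conjI ballI)
      show "gholo (ball 0 d) (root_prod f)" using f(1) by (intro gholo_root_prod) (simp add: V_def)
      show "root_prod f z \<noteq> 0" using f(2) by (simp add: root_prod_eq_0_iff[OF z])
      fix x assume "x \<in> {z. \<exists>t. cmod t < \<rho> \<and> z + axis i t \<in> X} \<inter> ball 0 d"
      then obtain t where x: "x \<in> ball 0 d" and t: "cmod t < \<rho>" "x + axis i t \<in> X" by blast
      moreover have "x + axis i t \<in> ball 0 r" using in_ball'[OF x] t(1) by simp
      ultimately show "root_prod f x = 0"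
        using f(1) gX by (auto simp: root_prod_eq_0_iff V_def roots_def)
    qed
  qed
  then show ?thesis using that[of \<rho> d] \<rho> d le by blast
qed

text \<open>The projection forgetting the coordinates in \<open>S\<close>, kept inside the same
  space so that successive projections share one type.\<close>

definition zero_on :: "'n set \<Rightarrow> (complex, 'n::finite) vec \<Rightarrow> (complex, 'n) vec" where
  "zero_on S z = (\<chi> i. if i \<in> S then 0 else z $ i)"

lemma zero_on_nth [simp]: "zero_on S z $ i = (if i \<in> S then 0 else z $ i)"
  by (simp add: zero_on_def)

lemma norm_zero_on_le: "norm (zero_on S z) \<le> norm z"
  by (rule norm_le_componentwise_cart) simp

lemma zero_on_insert: "i \<notin> S \<Longrightarrow> zero_on S z = zero_on (insert i S) z + axis i (z $ i)"
  by (simp add: vec_eq_iff axis_def)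

text \<open>Remmert's proper mapping theorem for a projection that is finite on \<open>X\<close>: the coordinates in
  \<open>S\<close> are eliminated one by one.\<close>

lemma analytic_in_project:
  fixes X :: "(complex, 'n::finite) vec set"
  assumes "finite S" and X: "analytic_in r X" and \<epsilon>: "0 < \<epsilon>" "\<epsilon> \<le> r"
    and "\<And>x. x \<in> X \<Longrightarrow> x \<in> ball 0 r \<Longrightarrow> (\<forall>i. i \<notin> S \<longrightarrow> x $ i = 0) \<Longrightarrow> x = 0"
  shows "\<exists>d Y. 0 < d \<and> d \<le> \<epsilon> \<and> analytic_in d Y \<and>
    (\<forall>z\<in>Y \<inter> ball 0 d. \<exists>x\<in>X \<inter> ball 0 \<epsilon>. \<forall>i. i \<notin> S \<longrightarrow> x $ i = z $ i) \<and>
    (\<forall>x\<in>X \<inter> ball 0 d. zero_on S x \<in> Y)"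
  using assms(1,5)
proof (induction S rule: finite_induct)
  case empty
  have "zero_on {} x = x" for x :: "(complex, 'n) vec" by (simp add: vec_eq_iff)
  moreover have "\<forall>z\<in>X \<inter> ball 0 \<epsilon>. \<exists>x\<in>X \<inter> ball 0 \<epsilon>. \<forall>i. i \<notin> {} \<longrightarrow> x $ i = z $ i" by blast
  ultimately show ?case
    using \<epsilon> analytic_in_mono[OF X \<epsilon>(2)] by (intro exI[of _ \<epsilon>] exI[of _ X]) auto
next
  case (insert i S)
  have "x = 0" if "x \<in> X" "x \<in> ball 0 r" "\<forall>i. i \<notin> S \<longrightarrow> x $ i = 0" for x
    using that by (intro insert.prems) auto
  from insert.IH[OF this] obtain d Y where dY: "0 < d" "d \<le> \<epsilon>" "analytic_in d Y"
    and a: "\<forall>z\<in>Y \<inter> ball 0 d. \<exists>x\<in>X \<inter> ball 0 \<epsilon>. \<forall>i. i \<notin> S \<longrightarrow> x $ i = z $ i"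
    and b: "\<forall>x\<in>X \<inter> ball 0 d. zero_on S x \<in> Y"
    by blast
  \<comment> \<open>A point of \<open>Y\<close> on the axis lifts to a point of \<open>X\<close>
    whose coordinates outside \<open>insert i S\<close> vanish. By assumption that point is
    0.\<close>
  have noaxis: "axis i t \<notin> Y" if t: "0 < cmod t" "cmod t < d" for t
  proof
    assume "axis i t \<in> Y"
    then obtain x where x: "x \<in> X \<inter> ball 0 \<epsilon>" "\<forall>j. j \<notin> S \<longrightarrow> x $ j = axis i t $ j"
      using bspec[OF a, of "axis i t"] t by (auto simp: norm_axis)
    then have "x = 0" using \<epsilon> by (intro insert.prems) (auto simp: axis_def)
    then show False using x(2) insert.hyps t(1) by (auto simp: axis_def)
  qed
  obtain \<rho> d' where d': "\<rho> > 0" "d' > 0" "\<rho> + d' \<le> d"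
    and Y': "analytic_in d' {z. \<exists>t. cmod t < \<rho> \<and> z + axis i t \<in> Y}"
    using analytic_in_project_axis[OF dY(3,1) noaxis] by blast
  show ?case
  \<comment> \<open>Below \<open>d'\<close> the new set is analytic; below \<open>\<rho>\<close> the
    coordinate \<open>x $ i\<close> is an admissible \<open>t\<close>.\<close>
  proof (intro exI[of _ "min d' \<rho>"] exI[of _ "{z. \<exists>t. cmod t < \<rho> \<and> z + axis i t \<in> Y}"] conjI ballI)
    show "0 < min d' \<rho>" "min d' \<rho> \<le> \<epsilon>" using d' dY by auto
    show "analytic_in (min d' \<rho>) {z. \<exists>t. cmod t < \<rho> \<and> z + axis i t \<in> Y}"
      by (rule analytic_in_mono[OF Y']) simp
    fix z assume "z \<in> {z. \<exists>t. cmod t < \<rho> \<and> z + axis i t \<in> Y} \<inter> ball 0 (min d' \<rho>)"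
    then obtain t where z: "norm z < d'" and t: "cmod t < \<rho>" "z + axis i t \<in> Y" by auto
    have "norm (z + axis i t) < d"
      using norm_triangle_ineq[of z "axis i t"] z t d' by (simp add: norm_axis)
    with bspec[OF a, of "z + axis i t"] t obtain x where "x \<in> X \<inter> ball 0 \<epsilon>"
      "\<forall>j. j \<notin> S \<longrightarrow> x $ j = (z + axis i t) $ j" by auto
    then show "\<exists>x\<in>X \<inter> ball 0 \<epsilon>. \<forall>j. j \<notin> insert i S \<longrightarrow> x $ j = z $ j"
      by (intro bexI[of _ x]) (auto simp: axis_def)
  next
    fix x assume x: "x \<in> X \<inter> ball 0 (min d' \<rho>)"
    then have "zero_on S x \<in> Y" using d' by (intro bspec[OF b]) auto
    moreover have "cmod (x $ i) < \<rho>" using x Finite_Cartesian_Product.norm_nth_le[where x = x and i = i] by auto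
    ultimately show "zero_on (insert i S) x \<in> {z. \<exists>t. cmod t < \<rho> \<and> z + axis i t \<in> Y}"
      using zero_on_insert[OF insert.hyps(2), of x] by (auto intro!: exI[of _ "x $ i"])
  qed
qed

section \<open>Fibres of holomorphic maps\<close>

definition fst_vec :: "(complex, 'a::finite + 'b::finite) vec \<Rightarrow> (complex, 'a) vec" where
  "fst_vec w = (\<chi> i. w $ Inl i)"

definition pair_vec :: "(complex, 'a::finite) vec \<Rightarrow> (complex, 'b::finite) vec \<Rightarrow> (complex, 'a + 'b) vec" where
  "pair_vec x y = (\<chi> k. case k of Inl i \<Rightarrow> x $ i | Inr j \<Rightarrow> y $ j)"

lemma fst_vec_nth [simp]: "fst_vec w $ i = w $ Inl i"
  by (simp add: fst_vec_def)

lemma pair_vec_nth [simp]: "pair_vec x y $ Inl i = x $ i" "pair_vec x y $ Inr j = y $ j"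
  by (simp_all add: pair_vec_def)

lemma fst_pair_vec [simp]: "fst_vec (pair_vec x y) = x"
  by (simp add: vec_eq_iff)

lemma sum_vec_eq_iff:
  "w = w' \<longleftrightarrow> (\<forall>i. w $ Inl i = w' $ Inl i) \<and> (\<forall>j. w $ Inr j = w' $ Inr j)"
  for w w' :: "('c, 'a::finite + 'b::finite) vec"
  unfolding vec_eq_iff by (metis sum.exhaust_sel)

lemma Inl_mem_image_iff [simp]: "Inl i \<in> Inl ` S \<longleftrightarrow> i \<in> S"
  by auto

lemma norm_pair_vec: "norm (pair_vec x y) = sqrt ((norm x)\<^sup>2 + (norm y)\<^sup>2)"
  by (simp add: norm_vec_def L2_set_def sum.Plus sum_nonneg flip: UNIV_Plus_UNIV)

lemma norm_pair_vec_le: "norm (pair_vec x y) \<le> norm x + norm y"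
  by (simp add: norm_pair_vec sqrt_sum_squares_le_sum)

lemma norm_fst_vec_le: "norm (fst_vec w) \<le> norm w"
proof -
  have "w = pair_vec (fst_vec w) (\<chi> j. w $ Inr j)" by (simp add: sum_vec_eq_iff)
  then show ?thesis by (metis norm_pair_vec real_sqrt_sum_squares_ge1)
qed

lemma clinear_map_fst_vec: "clinear_map fst_vec"
  by (rule clinear_mapI) (simp_all add: vec_eq_iff)

lemma gholo_fst_vec:
  "gholo (ball 0 r) f \<Longrightarrow> gholo (ball 0 r) (\<lambda>w. f (fst_vec w))"
  by (rule gholo_compose_linear[OF clinear_map_fst_vec])
     (auto intro: le_less_trans[OF norm_fst_vec_le])

text \<open>The graph of \<open>x \<mapsto> (f\<^sub>j x - f\<^sub>j 0)\<^sub>j\<close>; passing to it turns the values of \<open>f\<close> into coordinates.\<close>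

definition graph_of :: "'j set \<Rightarrow> ('j \<Rightarrow> (complex, 'a::finite) vec \<Rightarrow> complex) \<Rightarrow> (complex, 'a + 'j::finite) vec set" where
  "graph_of J f = {w. \<forall>j. w $ Inr j = (if j \<in> J then f j (fst_vec w) - f j 0 else 0)}"

definition graph_pt :: "'j set \<Rightarrow> ('j \<Rightarrow> (complex, 'a::finite) vec \<Rightarrow> complex) \<Rightarrow> (complex, 'a) vec \<Rightarrow> (complex, 'a + 'j::finite) vec" where
  "graph_pt J f x = pair_vec x (\<chi> j. if j \<in> J then f j x - f j 0 else 0)"

lemma graph_ofD: "w \<in> graph_of J f \<Longrightarrow> j \<in> J \<Longrightarrow> w $ Inr j = f j (fst_vec w) - f j 0"
  by (auto simp: graph_of_def dest: spec[of _ j])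

lemma graph_pt_in_graph: "graph_pt J f x \<in> graph_of J f"
  by (simp add: graph_of_def graph_pt_def)

lemma graph_pt_nth [simp]:
  "graph_pt J f x $ Inl i = x $ i" "graph_pt J f x $ Inr j = (if j \<in> J then f j x - f j 0 else 0)"
  by (simp_all add: graph_pt_def)

lemma analytic_in_graph_of:
  assumes "\<And>j. j \<in> J \<Longrightarrow> gholo (ball 0 r) (f j)"
  shows "analytic_in r (graph_of J f)"
  unfolding analytic_in_def
proof (intro ballI impI)
  fix z assume "z \<in> ball 0 r" "z \<notin> graph_of J f"
  then obtain j where j: "z $ Inr j \<noteq> (if j \<in> J then f j (fst_vec z) - f j 0 else 0)"
    by (auto simp: graph_of_def)
  show "\<exists>h. gholo (ball 0 r) h \<and> (\<forall>x\<in>graph_of J f \<inter> ball 0 r. h x = 0) \<and> h z \<noteq> 0"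
  proof (intro exI[of _ "\<lambda>w. w $ Inr j - (if j \<in> J then f j (fst_vec w) - f j 0 else 0)"] conjI)
    show "gholo (ball 0 r) (\<lambda>w. w $ Inr j - (if j \<in> J then f j (fst_vec w) - f j 0 else 0))"
      using gholo_fst_vec[OF assms, of j]
      by (cases "j \<in> J") (auto intro!: gholo_diff gholo_coord gholo_const)
  qed (use j in \<open>auto simp: graph_of_def\<close>)
qed

lemma eventually_graph_pt_small:
  fixes f :: "'j::finite \<Rightarrow> (complex, 'a::finite) vec \<Rightarrow> complex"
  assumes f: "\<And>j. j \<in> J \<Longrightarrow> gholo (ball 0 r) (f j)" and r: "r > 0" and e: "e > 0"
  shows "\<exists>d>0. d \<le> r \<and> (\<forall>x\<in>ball 0 d. graph_pt J f x \<in> ball 0 e)"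
proof -
  define y where "y = (\<lambda>x. \<chi> j. if j \<in> J then f j x - f j 0 else 0)"
  have "continuous_on (ball 0 r) y"
    unfolding y_def
  proof (intro continuous_on_vec_lambda)
    fix j show "continuous_on (ball 0 r) (\<lambda>x. if j \<in> J then f j x - f j 0 else 0)"
      using gholo_continuous_on[OF f, of j] by (cases "j \<in> J") (auto intro!: continuous_intros)
  qed
  then have "isCont y 0" using r by (simp add: continuous_on_eq_continuous_at)
  moreover have "y 0 = 0" by (simp add: y_def vec_eq_iff)
  ultimately obtain d where d: "d > 0" "\<And>x. norm x < d \<Longrightarrow> norm (y x) < e / 2"
    using e unfolding continuous_at_eps_delta by (metis diff_zero half_gt_zero dist_norm)
  have "graph_pt J f x \<in> ball 0 e" if "x \<in> ball 0 (min (min d r) (e / 2))" for x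
    using norm_pair_vec_le[of x "y x"] d(2)[of x] that by (simp add: graph_pt_def y_def)
  then show ?thesis using d(1) r e by (intro exI[of _ "min (min d r) (e / 2)"]) auto
qed

section \<open>Finiteness of nearby fibres\<close>

lemma finite_vec_set:
  assumes "\<And>i. finite (A i)"
  shows "finite {x :: ('c, 'a::finite) vec. \<forall>i. x $ i \<in> A i}"
proof (rule finite_subset)
  show "finite (vec_lambda ` (PiE UNIV A))" using assms by (intro finite_imageI finite_PiE) auto
  show "{x :: ('c, 'a) vec. \<forall>i. x $ i \<in> A i} \<subseteq> vec_lambda ` (PiE UNIV A)"
    by (force intro!: image_eqI[where x = "vec_nth _"] simp: vec_eq_iff)
qed

lemma uniform_radius:
  fixes P :: "'i::finite \<Rightarrow> real \<Rightarrow> bool"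
  assumes "\<And>i. \<exists>d>0. P i d" and "\<And>i d e. P i d \<Longrightarrow> 0 < e \<Longrightarrow> e \<le> d \<Longrightarrow> P i e" and "r > 0"
  shows "\<exists>d>0. d \<le> r \<and> (\<forall>i. P i d)"
proof -
  obtain D where D: "\<And>i. D i > 0" "\<And>i. P i (D i)" using assms(1) by metis
  define d where "d = Min (insert r (range D))"
  have "d > 0" "d \<le> r" using D(1) assms(3) by (auto simp: d_def)
  moreover have "d \<le> D i" for i unfolding d_def by (rule Min_le) auto
  ultimately show ?thesis using assms(2)[OF D(2)] by blast
qed

text \<open>It suffices that each coordinate \<open>i\<close> in \<open>S\<close> takes finitely
  many values on a fibre. Eliminating the other coordinates in \<open>S\<close> from the graph
  leaves an analytic set that meets the \<open>i\<close>-axis at most in 0, hence lies in the zero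
  set of some \<open>g\<close> with finitely many zeros on each slice.\<close>

lemma finite_nearby_fibres:
  fixes f :: "'j::finite \<Rightarrow> (complex, 'a::finite) vec \<Rightarrow> complex"
  assumes r: "r > 0" and f: "\<And>j. j \<in> J \<Longrightarrow> gholo (ball 0 r) (f j)"
    and iso: "\<And>x. x \<in> ball 0 r \<Longrightarrow> (\<forall>i. i \<notin> S \<longrightarrow> x $ i = 0) \<Longrightarrow> (\<forall>j\<in>J. f j x = f j 0) \<Longrightarrow> x = 0"
  shows "\<exists>d>0. d \<le> r \<and>
    (\<forall>b. finite {x \<in> ball 0 d. (\<forall>i. i \<notin> S \<longrightarrow> x $ i = b $ i) \<and> (\<forall>j\<in>J. f j x = f j b)})"
proof -
  define fibre where "fibre = (\<lambda>d b. {x \<in> ball 0 d. (\<forall>i. i \<notin> S \<longrightarrow> x $ i = b $ i) \<and> (\<forall>j\<in>J. f j x = f j b)})"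
  have "\<exists>d>0. \<forall>b. finite ((\<lambda>x. x $ i) ` fibre d b)" for i
  proof (cases "i \<in> S")
    case False
    have "finite ((\<lambda>x. x $ i) ` fibre 1 b)" for b
      by (rule finite_subset[of _ "{b $ i}"]) (use False in \<open>auto simp: fibre_def\<close>)
    then show ?thesis by (intro exI[of _ 1]) auto
  next
    case i: True
    \<comment> \<open>What remains are the coordinate \<open>i\<close>, the coordinates outside
      \<open>S\<close> and the values of the functions; all but the first are fixed on a
      fibre.\<close>
    define T where "T = (Inl ` (S - {i}) :: ('a + 'j) set)"
    have "\<exists>d (Y :: (complex, 'a + 'j) vec set). 0 < d \<and> d \<le> r \<and> analytic_in d Y \<and>
      (\<forall>z\<in>Y \<inter> ball 0 d. \<exists>x\<in>graph_of J f \<inter> ball 0 r. \<forall>k. k \<notin> T \<longrightarrow> x $ k = z $ k) \<and>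
      (\<forall>x\<in>graph_of J f \<inter> ball 0 d. zero_on T x \<in> Y)"
    proof (rule analytic_in_project)
      fix w assume w: "w \<in> graph_of J f" "w \<in> ball 0 r" and 0: "\<forall>k. k \<notin> T \<longrightarrow> w $ k = 0"
      have "fst_vec w = 0"
      proof (rule iso)
        show "fst_vec w \<in> ball 0 r" using w(2) norm_fst_vec_le[of w] by simp
        show "\<forall>l. l \<notin> S \<longrightarrow> fst_vec w $ l = 0" using 0 by (auto simp: T_def)
        show "\<forall>j\<in>J. f j (fst_vec w) = f j 0"
        proof
          fix j assume "j \<in> J"
          moreover have "w $ Inr j = 0" using 0 by (auto simp: T_def)
          ultimately show "f j (fst_vec w) = f j 0"
            using graph_ofD[OF w(1)] by simp
        qed
      qed
      then show "w = 0" using 0 by (auto simp: sum_vec_eq_iff T_def vec_eq_iff[of "fst_vec w"])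
    qed (use r f in \<open>auto intro: analytic_in_graph_of\<close>)
    then obtain d Y where dY: "0 < d" "d \<le> r" "analytic_in d Y"
      and a: "\<forall>z\<in>Y \<inter> ball 0 d. \<exists>x\<in>graph_of J f \<inter> ball 0 r. \<forall>k. k \<notin> T \<longrightarrow> x $ k = z $ k"
      and b: "\<forall>x\<in>graph_of J f \<inter> ball 0 d. zero_on T x \<in> Y"
      by blast
    have noaxis: "axis (Inl i) t \<notin> Y" if t: "0 < cmod t" "cmod t < d" for t
    proof
      assume "axis (Inl i) t \<in> Y"
      then obtain w where w: "w \<in> graph_of J f" "w \<in> ball 0 r" "\<forall>k. k \<notin> T \<longrightarrow> w $ k = axis (Inl i) t $ k"
        using bspec[OF a, of "axis (Inl i) t"] t by (auto simp: norm_axis)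
      have "fst_vec w = 0"
      proof (rule iso)
        show "fst_vec w \<in> ball 0 r" using w(2) norm_fst_vec_le[of w] by simp
        show "\<forall>l. l \<notin> S \<longrightarrow> fst_vec w $ l = 0" using w(3) i by (auto simp: T_def axis_def)
        show "\<forall>j\<in>J. f j (fst_vec w) = f j 0"
        proof
          fix j assume "j \<in> J"
          moreover have "w $ Inr j = 0" using w(3) by (auto simp: T_def axis_def)
          ultimately show "f j (fst_vec w) = f j 0"
            using graph_ofD[OF w(1)] by simp
        qed
      qed
      then have "w $ Inl i = 0" by (auto simp: vec_eq_iff)
      moreover have "w $ Inl i = t" using w(3) by (auto simp: T_def axis_def)
      ultimately show False using t(1) by simp
    qed
    obtain g \<rho> e where rf: "root_family g (Inl i) d \<rho> e" and gY: "\<And>w. w \<in> Y \<Longrightarrow> w \<in> ball 0 d \<Longrightarrow> g w = 0"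
      using root_family_if_analytic_in[OF dY(3,1) noaxis] by blast
    interpret root_family g "Inl i" d \<rho> e by (rule rf)
    have "min e \<rho> > 0" using \<rho> d by simp
    have "\<exists>s>0. s \<le> r \<and> (\<forall>x\<in>ball 0 s. graph_pt J f x \<in> ball 0 (min e \<rho>))"
      by (rule eventually_graph_pt_small[OF f r \<open>min e \<rho> > 0\<close>])
    then obtain s where s: "s > 0" "s \<le> r" "\<And>x. x \<in> ball 0 s \<Longrightarrow> graph_pt J f x \<in> ball 0 (min e \<rho>)" by blast
    have "finite ((\<lambda>x. x $ i) ` fibre s b)" for b
    proof (cases "fibre s b = {}")
      case False
      then obtain x0 where x0: "x0 \<in> fibre s b" by blast
      \<comment> \<open>The base point of the slice. With the coordinate \<open>i\<close> removed as
        well, it is the same for all points of the fibre, so any \<open>x0\<close> may define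
        it.\<close>
      define w0 where "w0 = zero_on (Inl ` S) (graph_pt J f x0)"
      have w0: "w0 \<in> ball 0 e"
        using norm_zero_on_le[of "Inl ` S" "graph_pt J f x0"] s(3)[of x0] x0
        by (auto simp: w0_def fibre_def)
      have "(\<lambda>x. x $ i) ` fibre s b \<subseteq> roots w0"
      proof
        fix t assume "t \<in> (\<lambda>x. x $ i) ` fibre s b"
        then obtain x where x: "x \<in> fibre s b" "t = x $ i" by blast
        have small: "norm (graph_pt J f x) < e" "norm (graph_pt J f x) < \<rho>"
          using s(3)[of x] x by (auto simp: fibre_def)
        have eq: "zero_on T (graph_pt J f x) = w0 + axis (Inl i) t"
          using x x0 i by (auto simp: sum_vec_eq_iff w0_def T_def fibre_def axis_def)
        have "graph_pt J f x \<in> ball 0 d" using small(1) le \<rho> by simp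
        then have "zero_on T (graph_pt J f x) \<in> Y" "zero_on T (graph_pt J f x) \<in> ball 0 d"
          using b graph_pt_in_graph[of J f x] norm_zero_on_le[of T "graph_pt J f x"] by auto
        then have "g (w0 + axis (Inl i) t) = 0" unfolding eq by (rule gY)
        moreover have "cmod t < \<rho>"
          using small(2) Finite_Cartesian_Product.norm_nth_le[where x = "graph_pt J f x" and i = "Inl i"] x(2) by simp
        ultimately show "t \<in> roots w0" by (simp add: roots_def)
      qed
      then show ?thesis using finite_roots[OF w0] finite_subset by blast
    qed simp
    then show ?thesis using s(1) by blast
  qed
  then have "\<exists>d>0. d \<le> r \<and> (\<forall>i. \<forall>b. finite ((\<lambda>x. x $ i) ` fibre d b))"
  proof (rule uniform_radius)
    fix i d and e :: real assume "\<forall>b. finite ((\<lambda>x. x $ i) ` fibre d b)" "e \<le> d"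
    moreover from \<open>e \<le> d\<close> have sub: "fibre e b \<subseteq> fibre d b" for b by (auto simp: fibre_def)
    ultimately show "\<forall>b. finite ((\<lambda>x. x $ i) ` fibre e b)"
      by (meson finite_subset image_mono sub)
  qed (rule r)
  then obtain d where d: "d > 0" "d \<le> r" "\<And>i b. finite ((\<lambda>x. x $ i) ` fibre d b)" by blast
  have "finite (fibre d b)" for b
  proof (rule finite_subset)
    show "fibre d b \<subseteq> {x. \<forall>i. x $ i \<in> (\<lambda>x. x $ i) ` fibre d b}" by blast
    show "finite {x. \<forall>i. x $ i \<in> (\<lambda>x. x $ i) ` fibre d b}"
      by (rule finite_vec_set) (rule d(3))
  qed
  then show ?thesis using d(1,2) by (intro exI[of _ d] conjI allI) (simp_all only: fibre_def)
qed

lemma axis_zero [simp]: "axis i 0 = (0 :: ('b::zero, 'a::finite) vec)"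
  by (simp add: vec_eq_iff axis_def)

section \<open>Common zeros of few functions\<close>

text \<open>The coordinates in \<open>S\<close> are set to 0 one at a time. Each move stays in the
  convex set \<open>D\<close> of admissible parameters, where the derivative vanishes.\<close>

lemma constant_on_slice:
  fixes f :: "(complex, 'a::finite) vec \<Rightarrow> complex"
  assumes f: "gholo (ball 0 d) f"
    and der: "\<And>b i. b \<in> ball 0 d \<Longrightarrow> (\<forall>i. i \<notin> S \<longrightarrow> b $ i = 0) \<Longrightarrow> i \<in> S \<Longrightarrow> dir_deriv (axis i 1) f b = 0"
    and x: "x \<in> ball 0 d" "\<forall>i. i \<notin> S \<longrightarrow> x $ i = 0"
  shows "f x = f 0"
proof -
  have "f (zero_on T x) = f x" if "T \<subseteq> S" for T
    using finite[of T] that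
  proof (induction T rule: finite_induct)
    case empty
    have "zero_on {} x = x" by (simp add: vec_eq_iff)
    then show ?case by simp
  next
    case (insert i T)
    define y where "y = zero_on (insert i T) x"
    define D where "D = {s. y + axis i s \<in> ball 0 d}"
    have eq: "zero_on T x = y + axis i (x $ i)"
      using zero_on_insert[OF insert.hyps(2)] by (simp add: y_def)
    have "open D"
      using open_line[OF open_ball, of y "axis i 1" 0 d] by (simp only: D_def axis_eq_smult[symmetric])
    have "convex D"
    proof (rule convexI)
      fix s t and u v :: real assume *: "s \<in> D" "t \<in> D" "0 \<le> u" "0 \<le> v" "u + v = 1"
      have "y + axis i (u *\<^sub>R s + v *\<^sub>R t) = u *\<^sub>R (y + axis i s) + v *\<^sub>R (y + axis i t)"
        using *(5) by (auto simp: vec_eq_iff axis_def scaleR_add_left[symmetric] algebra_simps)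
      moreover have "u *\<^sub>R (y + axis i s) + v *\<^sub>R (y + axis i t) \<in> ball 0 d"
        using * by (intro convexD[OF convex_ball]) (auto simp: D_def)
      ultimately show "u *\<^sub>R s + v *\<^sub>R t \<in> D" by (simp add: D_def)
    qed
    have "\<exists>c. \<forall>s\<in>D. f (y + axis i s) = c"
    proof (rule has_field_derivative_zero_constant[OF \<open>convex D\<close>])
      fix s assume s: "s \<in> D"
      have "(\<lambda>s. f (y + axis i s)) holomorphic_on D"
        using gholo_axis[OF f, of y i] by (simp add: D_def)
      from holomorphic_derivI[OF this \<open>open D\<close> s, of D]
      have "((\<lambda>s. f (y + axis i s)) has_field_derivative deriv (\<lambda>s. f (y + axis i s)) s) (at s within D)" .
      moreover have "dir_deriv (axis i 1) f (y + axis i s) = 0"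
        using s insert.prems x(2) by (intro der) (auto simp: D_def y_def axis_def)
      ultimately show "((\<lambda>s. f (y + axis i s)) has_field_derivative 0) (at s within D)"
        by (simp add: deriv_axis_line)
    qed
    moreover have "norm (zero_on T x) < d" "norm y < d"
      using x(1) norm_zero_on_le[of T x] norm_zero_on_le[of "insert i T" x] by (auto simp: y_def)
    from this have "x $ i \<in> D" "0 \<in> D" by (simp_all add: D_def flip: eq)
    ultimately have "f (zero_on T x) = f (y + axis i 0)" unfolding eq by metis
    then show ?case using insert by (simp add: y_def)
  qed
  from this[of S] have "f (zero_on S x) = f x" by simp
  moreover have "zero_on S x = 0" using x(2) by (simp add: vec_eq_iff)
  ultimately show ?thesis by simp
qed

text \<open>An implicit function theorem: over 0 there is one simple zero, and the number of zeros
  is constant. Then \<open>root_sum \<phi>\<close> is \<open>\<phi>\<close> restricted to the zero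
  set of \<open>g\<close>, parametrised by \<open>z\<close>, and is known to be holomorphic.\<close>

lemma (in root_family) simple_root:
  assumes only: "\<And>t. cmod t < \<rho> \<Longrightarrow> g (axis i t) = 0 \<longleftrightarrow> t = 0"
    and der: "dir_deriv (axis i 1) g 0 \<noteq> 0" and z: "z \<in> ball 0 d"
  shows "\<exists>\<tau>. cmod \<tau> < \<rho> \<and> g (z + axis i \<tau>) = 0 \<and> (\<forall>\<phi>. root_sum \<phi> z = \<phi> (z + axis i \<tau>))"
proof -
  have 0: "0 \<in> ball (0 :: (complex, 'n) vec) d" using d by simp
  have g0: "g 0 = 0" using only[of 0] \<rho> by simp
  have r0: "roots 0 = {0}" using only \<rho> g0 by (auto simp: roots_def)
  have "zorder (\<lambda>s. g (0 + axis i s)) 0 = 1"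
  proof (rule zorder_zero_eqI[OF slice_holo[OF g]])
    show "(0::complex) \<in> ball 0 (r - norm (0 :: (complex, 'n) vec))" using le \<rho> d by simp
    show "(deriv ^^ k) (\<lambda>t. g (0 + axis i t)) 0 = 0" if "k < nat 1" for k
      using that g0 by simp
    show "(deriv ^^ nat 1) (\<lambda>t. g (0 + axis i t)) 0 \<noteq> 0"
      using der deriv_axis_line[of g 0 i 0] by simp
  qed auto
  then have "(\<Sum>t\<in>roots 0. mult 0 t) = 1" by (simp add: r0 mult_def)
  then have "(\<Sum>t\<in>roots z. mult z t) = 1" using mult_sum_const 0 z by metis
  then obtain \<tau> where \<tau>: "\<tau> \<in> roots z" "mult z \<tau> = 1" "\<forall>t\<in>roots z. \<tau> \<noteq> t \<longrightarrow> mult z t = 0"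
    using sum_eq_1_iff[OF finite_roots[OF z]] by auto
  then have "roots z = {\<tau>}" using mult_pos[OF z] by force
  then show ?thesis using \<tau> by (intro exI[of _ \<tau>]) (auto simp: root_sum_def roots_def)
qed

text \<open>Induction on the number of functions: at a nearby point where some function has a nonzero partial
  derivative, its level set is a graph over one coordinate less, and nearby fibres are still finite.\<close>

lemma exists_common_level:
  fixes f :: "'j::finite \<Rightarrow> (complex, 'a::finite) vec \<Rightarrow> complex"
  assumes "card J < card S" "r > 0" "\<And>j. j \<in> J \<Longrightarrow> gholo (ball 0 r) (f j)"
  shows "\<exists>x\<in>ball 0 r. x \<noteq> 0 \<and> (\<forall>i. i \<notin> S \<longrightarrow> x $ i = 0) \<and> (\<forall>j\<in>J. f j x = f j 0)"
  using finite[of J] assms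
proof (induction J arbitrary: S f r rule: finite_induct)
  case empty
  then obtain i where "i \<in> S" by fastforce
  define x where "x = (axis i (of_real (r / 2)) :: (complex, 'a) vec)"
  have "x \<in> ball 0 r" "x \<noteq> 0"
    using empty by (simp_all add: x_def norm_axis norm_divide axis_eq_0_iff)
  moreover have "\<forall>l. l \<notin> S \<longrightarrow> x $ l = 0" using \<open>i \<in> S\<close> by (auto simp: x_def axis_def)
  ultimately show ?case by blast
next
  case (insert j0 J)
  note f = insert.prems(3) and r = insert.prems(2)
  show ?case
  proof (rule ccontr)
    assume contr: "\<not> ?case"
    \<comment> \<open>Failure of the claim isolates 0 in its fibre. Finiteness is needed at the
      nearby points too, because the induction continues at another base point
      \<open>b\<close>.\<close>
    have "\<exists>d>0. d \<le> r \<and> (\<forall>b. finite {x \<in> ball 0 d. (\<forall>i. i \<notin> S \<longrightarrow> x $ i = b $ i) \<and>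
        (\<forall>j\<in>insert j0 J. f j x = f j b)})"
    proof (rule finite_nearby_fibres[OF r f])
      fix x assume "x \<in> ball 0 r" "\<forall>i. i \<notin> S \<longrightarrow> x $ i = 0" "\<forall>j\<in>insert j0 J. f j x = f j 0"
      then show "x = 0" using contr by meson
    qed
    then obtain d where d: "d > 0" "d \<le> r" and fin: "\<And>b. finite {x \<in> ball 0 d.
        (\<forall>i. i \<notin> S \<longrightarrow> x $ i = b $ i) \<and> (\<forall>j\<in>insert j0 J. f j x = f j b)}" by blast
    have fd: "gholo (ball 0 d) (f j)" if "j \<in> insert j0 J" for j
      by (rule gholo_subset[OF f[OF that]]) (use d in auto)
    have J: "card J < card (S - {i})" if "i \<in> S" for i
      using insert.prems(1) insert.hyps that by (simp add: card_Diff_singleton)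
    show False
    proof (cases "\<exists>b i. b \<in> ball 0 d \<and> (\<forall>i. i \<notin> S \<longrightarrow> b $ i = 0) \<and> i \<in> S \<and> dir_deriv (axis i 1) (f j0) b \<noteq> 0")
      \<comment> \<open>Here \<open>f j0\<close> is constant on the slice, so the remaining
        functions decide.\<close>
      case False
      have "card J < card S" using insert.prems(1) insert.hyps by simp
      from insert.IH[OF this d(1), of f] fd obtain x where
        x: "x \<in> ball 0 d" "x \<noteq> 0" "\<forall>i. i \<notin> S \<longrightarrow> x $ i = 0" "\<forall>j\<in>J. f j x = f j 0" by auto
      have "f j0 x = f j0 0"
        by (rule constant_on_slice[OF fd _ x(1,3)]) (use False in auto)
      with x contr d show False by auto
    next
      case True
      then obtain b i where b: "b \<in> ball 0 d" "\<forall>i. i \<notin> S \<longrightarrow> b $ i = 0" and i: "i \<in> S"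
        and der: "dir_deriv (axis i 1) (f j0) b \<noteq> 0" by blast
      define r' where "r' = d - norm b"
      have r': "r' > 0" using b by (simp add: r'_def)
      have shift: "gholo (ball 0 r') (\<lambda>z. f j (b + z))" if "j \<in> insert j0 J" for j
      proof (rule gholo_compose_affine[OF _ fd[OF that], where L = "\<lambda>z. z"])
        fix z :: "(complex, 'a) vec" assume "z \<in> ball 0 r'"
        then show "b + z \<in> ball 0 d" using norm_triangle_ineq[of b z] by (simp add: r'_def)
      qed (rule clinear_mapI; simp)
      define g where "g = (\<lambda>z. f j0 (b + z) - f j0 b)"
      have g: "gholo (ball 0 r') g" unfolding g_def by (intro gholo_diff gholo_const shift) simp
      define u where "u = (\<lambda>t. g (axis i t))"
      have u: "u holomorphic_on ball 0 r'"
        using gholo_axis[OF g, of 0 i] by (simp add: u_def norm_axis ball_def)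
      have "dir_deriv (axis i 1) g 0 = deriv (\<lambda>s. f j0 (b + s *s axis i 1) - f j0 b) 0"
        by (simp add: dir_deriv_def g_def)
      also have "\<dots> = deriv (\<lambda>s. f j0 (b + s *s axis i 1)) 0 - 0"
      proof (rule DERIV_imp_deriv, rule DERIV_diff)
        have "0 \<in> {s. b + s *s axis i 1 \<in> ball 0 d}" using b by simp
        moreover have "open {s. b + s *s axis i 1 \<in> ball 0 d}"
          by (rule open_line) simp
        ultimately show "((\<lambda>s. f j0 (b + s *s axis i 1)) has_field_derivative
            deriv (\<lambda>s. f j0 (b + s *s axis i 1)) 0) (at 0)"
          using gholo_line[OF fd, of j0 b "axis i 1"] by (intro holomorphic_derivI) auto
      qed auto
      finally have gder: "dir_deriv (axis i 1) g 0 \<noteq> 0" using der by (simp add: dir_deriv_def)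
      have ud: "deriv u 0 \<noteq> 0"
        using gder deriv_axis_line[of g 0 i 0] by (simp add: u_def)
      have u0: "u 0 = 0" by (simp add: u_def g_def)
      have "\<exists>\<beta>\<in>ball 0 r'. u \<beta> \<noteq> 0"
      proof (rule ccontr)
        assume "\<not> ?thesis"
        then have "eventually (\<lambda>t. u t = 0) (nhds 0)"
          unfolding eventually_nhds using r' by (intro exI[of _ "ball 0 r'"]) auto
        then have "deriv u 0 = deriv (\<lambda>_. 0) 0" by (intro deriv_cong_ev) auto
        then show False using ud by simp
      qed
      then obtain \<beta> where \<beta>: "\<beta> \<in> ball 0 r'" "u \<beta> \<noteq> 0" by blast
      have "0 \<in> ball (0::complex) r'" using r' by simp
      from isolated_zeros[OF u open_ball connected_ball this u0 \<beta>]
      obtain s where s: "0 < s" "ball 0 s \<subseteq> ball (0::complex) r'" "\<And>z. z \<in> ball 0 s - {0} \<Longrightarrow> u z \<noteq> 0" by metis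
      define \<rho> where "\<rho> = min (s / 2) (r' / 2)"
      have \<rho>: "0 < \<rho>" "\<rho> < r'" "\<rho> < s" using s r' by (auto simp: \<rho>_def)
      have only: "g (axis i t) = 0 \<longleftrightarrow> t = 0" if "cmod t \<le> \<rho>" for t
        using s(3)[of t] u0 that \<rho> by (cases "t = 0") (auto simp: u_def)
      obtain d' where "root_family g i r' \<rho> d'"
        by (rule root_family_if_circle[OF g \<rho>(1,2)]) (use only \<rho> in auto)
      then interpret rf: root_family g i r' \<rho> d' .
      \<comment> \<open>The functions \<open>f j\<close> restricted to the level set of
        \<open>f j0\<close> through \<open>b\<close>, in the coordinates other than
        \<open>i\<close>.\<close>
      define f' where "f' = (\<lambda>j. rf.root_sum (\<lambda>z. f j (b + z)))"
      define Z where "Z = {z \<in> ball 0 d'. (\<forall>l. l \<notin> S - {i} \<longrightarrow> z $ l = 0) \<and> (\<forall>j\<in>J. f' j z = f' j 0)}"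
      have simple: "\<exists>\<tau>. cmod \<tau> < \<rho> \<and> g (z + axis i \<tau>) = 0 \<and> (\<forall>\<phi>. rf.root_sum \<phi> z = \<phi> (z + axis i \<tau>))"
        if "z \<in> ball 0 d'" for z
        by (rule rf.simple_root[OF _ gder that]) (use only in auto)
      have f'0: "f' j 0 = f j b" for j
      proof -
        obtain \<tau> where \<tau>: "cmod \<tau> < \<rho>" "g (0 + axis i \<tau>) = 0" "\<forall>\<phi>. rf.root_sum \<phi> 0 = \<phi> (0 + axis i \<tau>)"
          using simple[of 0] rf.d by auto
        then have "\<tau> = 0" using only[of \<tau>] by simp
        then show ?thesis using \<tau>(3) by (simp add: f'_def)
      qed
      define Fb where "Fb = {x \<in> ball 0 d. (\<forall>i. i \<notin> S \<longrightarrow> x $ i = b $ i) \<and> (\<forall>j\<in>insert j0 J. f j x = f j b)}"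
      \<comment> \<open>A point of \<open>Z\<close> lifts by its root to the fibre of
        \<open>b\<close>; subtracting \<open>b\<close> and deleting the coordinate \<open>i\<close>
        recovers it.\<close>
      have "Z \<subseteq> (\<lambda>x. zero_on {i} (x - b)) ` Fb"
      proof
        fix z assume z: "z \<in> Z"
        then obtain \<tau> where \<tau>: "cmod \<tau> < \<rho>" "g (z + axis i \<tau>) = 0" "\<And>\<phi>. rf.root_sum \<phi> z = \<phi> (z + axis i \<tau>)"
          using simple[of z] by (auto simp: Z_def)
        define x where "x = b + (z + axis i \<tau>)"
        have "z + axis i \<tau> \<in> ball 0 r'" using z \<tau>(1) by (intro rf.in_ball') (auto simp: Z_def)
        then have "x \<in> ball 0 d" using norm_triangle_ineq[of b "z + axis i \<tau>"] by (simp add: x_def r'_def)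
        moreover have "\<forall>l. l \<notin> S \<longrightarrow> x $ l = b $ l"
          using z i by (auto simp: x_def Z_def axis_def)
        moreover have "f j x = f j b" if "j \<in> insert j0 J" for j
        proof (cases "j = j0")
          case True
          then show ?thesis using \<tau>(2) by (simp add: g_def x_def)
        next
          case False
          then have "f' j z = f' j 0" using that z by (auto simp: Z_def)
          then show ?thesis unfolding f'0 by (simp add: f'_def \<tau>(3) x_def)
        qed
        ultimately have "x \<in> Fb" by (simp add: Fb_def)
        moreover have "z = zero_on {i} (x - b)"
          using z by (auto simp: vec_eq_iff x_def Z_def axis_def)
        ultimately show "z \<in> (\<lambda>x. zero_on {i} (x - b)) ` Fb" by blast
      qed
      moreover have "finite Fb" unfolding Fb_def by (rule fin)
      ultimately have "finite Z" using finite_surj by blast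
      \<comment> \<open>The induction hypothesis, applied in arbitrarily small balls, contradicts
        finiteness of \<open>Z\<close>.\<close>
      moreover have "0 islimpt Z"
        unfolding islimpt_approachable
      proof (intro allI impI)
        fix e :: real assume e: "e > 0"
        define \<eta> where "\<eta> = min e d'"
        have \<eta>: "\<eta> > 0" "\<eta> \<le> d'" "\<eta> \<le> e" using e rf.d by (auto simp: \<eta>_def)
        have f': "gholo (ball 0 \<eta>) (f' j)" if "j \<in> J" for j
          by (rule gholo_subset[of "ball 0 d'"])
             (use \<eta> that in \<open>auto simp: f'_def intro!: rf.gholo_root_sum shift\<close>)
        have "\<exists>x\<in>ball 0 \<eta>. x \<noteq> 0 \<and> (\<forall>l. l \<notin> S - {i} \<longrightarrow> x $ l = 0) \<and> (\<forall>j\<in>J. f' j x = f' j 0)"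
          by (rule insert.IH[OF J[OF i] \<eta>(1) f'])
        then obtain x where
          "x \<in> ball 0 \<eta>" "x \<noteq> 0" "\<forall>l. l \<notin> S - {i} \<longrightarrow> x $ l = 0" "\<forall>j\<in>J. f' j x = f' j 0" by blast
        then show "\<exists>x'\<in>Z. x' \<noteq> 0 \<and> dist x' 0 < e"
          using \<eta> by (intro bexI[of _ x]) (auto simp: Z_def)
      qed
      ultimately show False using islimpt_finite by blast
    qed
  qed
qed


text \<open>The line parameter ranges over a disc of radius greater than 1, which contains both 0,
  where the restriction vanishes, and 1, where it does not; its zeros are therefore
  isolated.\<close>

lemma nonzero_on_line:
  fixes \<psi> :: "(complex, 'n::finite) vec \<Rightarrow> complex"
  assumes \<psi>: "gholo (ball 0 d) \<psi>" "\<psi> 0 = 0" "\<psi> v \<noteq> 0" and v: "norm v < d"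
  shows "\<exists>\<sigma>>0. \<forall>t. 0 < cmod t \<and> cmod t < \<sigma> \<longrightarrow> \<psi> (t *s v) \<noteq> 0"
proof -
  have "v \<noteq> 0" using \<psi> by auto
  define R where "R = d / norm v"
  have R: "R > 1" using v \<open>v \<noteq> 0\<close> by (simp add: R_def)
  have "t *s v \<in> ball 0 d" if "t \<in> ball 0 R" for t
    using that \<open>v \<noteq> 0\<close> by (simp add: R_def norm_vector_smult pos_less_divide_eq)
  then have "ball 0 R \<subseteq> {t. t *s v \<in> ball 0 d}" by blast
  then have hol: "(\<lambda>t. \<psi> (t *s v)) holomorphic_on ball 0 R"
    using holomorphic_on_subset gholo_line[OF \<psi>(1), of 0 v] by simp
  have "0 \<in> ball (0::complex) R" "1 \<in> ball (0::complex) R" using R by auto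
  moreover have "\<psi> (0 *s v) = 0" "\<psi> (1 *s v) \<noteq> 0" using \<psi> by simp_all
  ultimately obtain \<sigma> where \<sigma>: "0 < \<sigma>" "\<And>t. t \<in> ball 0 \<sigma> - {0} \<Longrightarrow> \<psi> (t *s v) \<noteq> 0"
    using isolated_zeros[OF hol open_ball connected_ball] by metis
  then show ?thesis by (intro exI[of _ \<sigma>]) auto
qed

text \<open>If the image, which is analytic, were proper, a line meeting it only at the origin would express the
  isolated zero by fewer equations than variables.\<close>

lemma open_at_isolated_zero:
  fixes G :: "(complex, 'p::finite) vec \<Rightarrow> (complex, 'p) vec"
  assumes r: "r > 0" and G: "\<And>i. gholo (ball 0 r) (\<lambda>x. G x $ i)" and G0: "G 0 = 0"
    and iso: "\<And>x. x \<in> ball 0 r \<Longrightarrow> G x = 0 \<Longrightarrow> x = 0" and \<epsilon>: "\<epsilon> > 0"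
  shows "\<exists>\<delta>>0. ball 0 \<delta> \<subseteq> G ` ball 0 \<epsilon>"
proof -
  define f where "f = (\<lambda>j x. G x $ j)"
  have f: "gholo (ball 0 r) (f j)" for j unfolding f_def by (rule G)
  \<comment> \<open>Eliminating the source coordinates projects the graph onto the target, so
    \<open>Y\<close> represents the image of \<open>G\<close>.\<close>
  define T where "T = (range Inl :: ('p + 'p) set)"
  define X where "X = (graph_of UNIV f :: (complex, 'p + 'p) vec set)"
  have XD: "w $ Inr j = G (fst_vec w) $ j" if "w \<in> X" for w j
    using graph_ofD[OF that[unfolded X_def], of j] by (simp add: f_def G0)
  define \<epsilon>' where "\<epsilon>' = min \<epsilon> r"
  have \<epsilon>': "0 < \<epsilon>'" "\<epsilon>' \<le> r" "\<epsilon>' \<le> \<epsilon>" using \<epsilon> r by (auto simp: \<epsilon>'_def)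
  have "\<exists>d (Y :: (complex, 'p + 'p) vec set). 0 < d \<and> d \<le> \<epsilon>' \<and> analytic_in d Y \<and>
      (\<forall>z\<in>Y \<inter> ball 0 d. \<exists>x\<in>X \<inter> ball 0 \<epsilon>'. \<forall>k. k \<notin> T \<longrightarrow> x $ k = z $ k) \<and>
      (\<forall>x\<in>X \<inter> ball 0 d. zero_on T x \<in> Y)"
  proof (rule analytic_in_project)
    show "analytic_in r X" unfolding X_def by (rule analytic_in_graph_of) (rule f)
    fix w assume w: "w \<in> X" "w \<in> ball 0 r" and 0: "\<forall>k. k \<notin> T \<longrightarrow> w $ k = 0"
    have y: "w $ Inr j = 0" for j using 0 by (auto simp: T_def)
    then have "G (fst_vec w) = 0" using XD[OF w(1)] by (simp add: vec_eq_iff)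
    moreover have "fst_vec w \<in> ball 0 r" using w(2) norm_fst_vec_le[of w] by simp
    ultimately have "fst_vec w = 0" by (intro iso[of "fst_vec w"])
    then show "w = 0" using y by (simp add: sum_vec_eq_iff vec_eq_iff[of "fst_vec w"])
  qed (use \<epsilon>' in auto)
  then obtain d Y where d: "0 < d" "d \<le> \<epsilon>'" and Y: "analytic_in d Y"
    and a: "\<forall>z\<in>Y \<inter> ball 0 d. \<exists>x\<in>X \<inter> ball 0 \<epsilon>'. \<forall>k. k \<notin> T \<longrightarrow> x $ k = z $ k"
    and b: "\<forall>x\<in>X \<inter> ball 0 d. zero_on T x \<in> Y" by blast
  show ?thesis
  proof (cases "\<forall>y\<in>ball 0 d. pair_vec 0 y \<in> Y")
    case True
    have "y \<in> G ` ball 0 \<epsilon>" if y: "y \<in> ball 0 d" for y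
    proof -
      have "pair_vec 0 y \<in> Y \<inter> ball 0 d" using True y by (simp add: norm_pair_vec)
      then obtain w where w: "w \<in> X" "w \<in> ball 0 \<epsilon>'" "\<forall>k. k \<notin> T \<longrightarrow> w $ k = pair_vec 0 y $ k"
        using a by blast
      have "w $ Inr j = y $ j" for j using w(3) by (auto simp: T_def)
      then have "G (fst_vec w) = y" using XD[OF w(1)] by (simp add: vec_eq_iff)
      moreover have "fst_vec w \<in> ball 0 \<epsilon>" using norm_fst_vec_le[of w] w(2) \<epsilon>' by simp
      ultimately show ?thesis by blast
    qed
    then show ?thesis using d(1) by blast
  next
    case False
    then obtain y0 where y0: "y0 \<in> ball 0 d" "pair_vec 0 y0 \<notin> Y" by blast
    define p where "p = (pair_vec 0 y0 :: (complex, 'p + 'p) vec)"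
    have pd: "norm p < d" using y0(1) by (simp add: p_def norm_pair_vec)
    then obtain \<psi> where \<psi>: "gholo (ball 0 d) \<psi>" "\<forall>x\<in>Y \<inter> ball 0 d. \<psi> x = 0" "\<psi> p \<noteq> 0"
      using Y y0(2) unfolding analytic_in_def p_def by auto
    have Y0: "0 \<in> Y"
    proof -
      have "fst_vec (0 :: (complex, 'p + 'p) vec) = 0" by (simp add: vec_eq_iff)
      then have "0 \<in> X" using G0 by (simp add: X_def graph_of_def f_def)
      then have "zero_on T 0 \<in> Y" using b d by simp
      moreover have "zero_on T 0 = 0" by (simp add: vec_eq_iff)
      ultimately show ?thesis by simp
    qed
    have "p \<noteq> 0" using Y0 y0(2) by (auto simp: p_def)
    then obtain i where i: "y0 $ i \<noteq> 0" by (auto simp: p_def sum_vec_eq_iff)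
    have "\<psi> 0 = 0" using \<psi>(2) Y0 d by simp
    from nonzero_on_line[OF \<psi>(1) this \<psi>(3) pd] obtain s where s: "0 < s"
      "\<And>t. 0 < cmod t \<Longrightarrow> cmod t < s \<Longrightarrow> \<psi> (t *s p) \<noteq> 0" by blast
    \<comment> \<open>The equations \<open>f' j x = 0\<close> for \<open>j \<noteq> i\<close> say
      that \<open>G x\<close> lies on the line through \<open>y0\<close>.\<close>
    define f' where "f' = (\<lambda>j x. G x $ j - (y0 $ j / y0 $ i) * G x $ i)"
    \<comment> \<open>The factor \<open>cmod (y0 $ i)\<close> ensures that the position of
      \<open>G x\<close> on that line has modulus below \<open>s\<close>.\<close>
    have "min d (s * cmod (y0 $ i)) > 0" using d s i by simp
    then have "\<exists>e>0. e \<le> r \<and> (\<forall>x\<in>ball 0 e. graph_pt UNIV f x \<in> ball 0 (min d (s * cmod (y0 $ i))))"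
      by (rule eventually_graph_pt_small[OF f r])
    then obtain e where
      e: "e > 0" "e \<le> r" "\<And>x. x \<in> ball 0 e \<Longrightarrow> graph_pt UNIV f x \<in> ball 0 (min d (s * cmod (y0 $ i)))"
      by blast
    have "\<exists>x\<in>ball 0 e. x \<noteq> 0 \<and> (\<forall>i. i \<notin> UNIV \<longrightarrow> x $ i = 0) \<and> (\<forall>j\<in>UNIV - {i}. f' j x = f' j 0)"
    proof (rule exists_common_level)
      show "card (UNIV - {i}) < CARD('p)" by (rule psubset_card_mono) auto
      fix j
      show "gholo (ball 0 e) (f' j)"
        unfolding f'_def using e(2)
        by (intro gholo_diff gholo_mult gholo_const gholo_subset[OF G]) auto
    qed (use e in auto)
    then obtain x where x: "x \<in> ball 0 e" "x \<noteq> 0" "\<And>j. j \<noteq> i \<Longrightarrow> f' j x = f' j 0" by blast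
    define t where "t = G x $ i / y0 $ i"
    have Gx: "G x = t *s y0"
    proof -
      have "G x $ j = (t *s y0) $ j" for j
        using x(3)[of j] i by (cases "j = i") (auto simp: f'_def t_def G0)
      then show ?thesis by (simp add: vec_eq_iff)
    qed
    have gp: "graph_pt UNIV f x \<in> X" "norm (graph_pt UNIV f x) < d" "norm (graph_pt UNIV f x) < s * cmod (y0 $ i)"
      using e(3)[OF x(1)] graph_pt_in_graph[of UNIV f x] by (auto simp: X_def)
    have "cmod (G x $ i) \<le> norm (graph_pt UNIV f x)"
      using Finite_Cartesian_Product.norm_nth_le[where x = "graph_pt UNIV f x" and i = "Inr i"]
      by (simp add: f_def G0)
    then have "cmod t < s" using gp(3) i by (simp add: t_def norm_divide divide_less_eq)
    have eq: "zero_on T (graph_pt UNIV f x) = t *s p"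
      by (auto simp: sum_vec_eq_iff T_def p_def f_def G0 Gx)
    have "t *s p \<in> Y" "t *s p \<in> ball 0 d"
      using b gp norm_zero_on_le[of T "graph_pt UNIV f x"] unfolding eq[symmetric] by auto
    then have "\<psi> (t *s p) = 0" using \<psi>(2) by blast
    then have "t = 0" using s(2)[of t] \<open>cmod t < s\<close> by force
    then have "G x = 0" by (simp add: Gx)
    then show ?thesis using iso[of x] x e by auto
  qed
qed

section \<open>Prime chains from ultrafilters\<close>

text \<open>Zorn's lemma on proper filters below \<open>F\<close>. A minimal one decides every
  \<open>P\<close>: if \<open>P\<close> is not refuted, intersecting with it keeps the filter
  proper, hence changes nothing.\<close>

lemma ex_ultrafilter:
  assumes "F \<noteq> bot"
  shows "\<exists>U\<le>F. U \<noteq> bot \<and> (\<forall>P. eventually P U \<or> eventually (\<lambda>x. \<not> P x) U)"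
proof -
  define A where "A = {G. G \<noteq> bot \<and> G \<le> F}"
  have "\<exists>m\<in>A. \<forall>G\<in>A. G \<le> m \<longrightarrow> G = m"
  proof (rule predicate_Zorn)
    show "partial_order_on A (relation_of (\<lambda>x y. y \<le> x) A)"
      by (rule partial_order_on_relation_ofI) auto
    fix C assume "C \<in> Chains (relation_of (\<lambda>x y. y \<le> x) A)"
    then have C: "C \<subseteq> A" "\<And>G H. G \<in> C \<Longrightarrow> H \<in> C \<Longrightarrow> G \<le> H \<or> H \<le> G"
      by (auto simp: Chains_def relation_of_def)
    show "\<exists>u\<in>A. \<forall>a\<in>C. u \<le> a"
    proof (cases "C = {}")
      case True
      then show ?thesis using assms by (auto simp: A_def)
    next
      case False
      have "eventually P (Inf C) \<longleftrightarrow> (\<exists>G\<in>C. eventually P G)" for P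
        using False C(2) by (intro eventually_Inf_base) (auto intro: inf.coboundedI1)
      then have "Inf C \<noteq> bot"
        using C(1) by (auto simp: A_def trivial_limit_def)
      moreover have "Inf C \<le> F" using False C(1) by (auto simp: A_def intro: Inf_lower2)
      ultimately show ?thesis by (intro bexI[of _ "Inf C"]) (auto simp: A_def Inf_lower)
    qed
  qed
  then obtain U where "U \<in> A" and maxA: "\<And>G. G \<in> A \<Longrightarrow> G \<le> U \<Longrightarrow> G = U" by blast
  then have U: "U \<noteq> bot" "U \<le> F" by (simp_all add: A_def)
  have max: "G = U" if "G \<noteq> bot" "G \<le> U" for G
    using that U(2) by (intro maxA) (auto simp: A_def)
  have "eventually P U" if "\<not> eventually (\<lambda>x. \<not> P x) U" for P
  proof -
    have "inf U (principal {x. P x}) \<noteq> bot"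
      using that by (simp add: trivial_limit_def eventually_inf_principal)
    then have "inf U (principal {x. P x}) = U" by (rule max) simp
    moreover have "eventually P (inf U (principal {x. P x}))" by (simp add: eventually_inf_principal)
    ultimately show ?thesis by simp
  qed
  then show ?thesis using U by blast
qed

text \<open>Images of primes containing \<open>I\<close> are prime, and the correspondence of ideals
  is injective, so strict inclusions survive.\<close>

lemma krull_dim_Quot_ge:
  assumes "cring R" "ideal I R"
    and prime: "\<And>i. i \<le> m \<Longrightarrow> primeideal (P i) R" and sub: "\<And>i. i \<le> m \<Longrightarrow> I \<subseteq> P i"
    and strict: "\<And>i. i < m \<Longrightarrow> P i \<subset> P (Suc i)"
  shows "enat m \<le> krull_dim (R Quot I)"
proof -
  interpret cring R by fact
  interpret I: ideal I R by fact
  define J where "J = (\<lambda>i. (+>\<^bsub>R\<^esub>) I ` P i)"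
  have idP: "ideal (P i) R" if "i \<le> m" for i using prime[OF that] by (rule primeideal.axioms(1))
  have bij: "bij_betw (\<lambda>J. (+>\<^bsub>R\<^esub>) I ` J) {J. ideal J R \<and> I \<subseteq> J} {J. ideal J (R Quot I)}"
    by (rule quot_ideal_correspondence) (rule I.ideal_axioms)
  have idJ: "ideal (J i) (R Quot I)" if "i \<le> m" for i
    using ring_ideal_imp_quot_ideal[OF I.ideal_axioms idP[OF that]] by (simp add: J_def)
  have mem: "I +>\<^bsub>R\<^esub> a \<in> J i \<longleftrightarrow> a \<in> P i" if "i \<le> m" "a \<in> carrier R" for i a
  proof -
    have "\<Union> (J i) = P i"
      using ideal_incl_iff[OF I.ideal_axioms idP[OF that(1)]] sub[OF that(1)] by (simp add: J_def)
    moreover have "J i \<subseteq> carrier (R Quot I)"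
      using idJ[OF that(1)] by (simp add: additive_subgroup.a_subset ideal.axioms(1))
    ultimately show ?thesis using canonical_proj_vimage_mem_iff[OF I.ideal_axioms _ that(2)] by metis
  qed
  have car: "\<exists>a\<in>carrier R. x = I +>\<^bsub>R\<^esub> a" if "x \<in> carrier (R Quot I)" for x
    using that by (auto simp: FactRing_def A_RCOSETS_def')
  have hom: "(+>\<^bsub>R\<^esub>) I \<in> ring_hom R (R Quot I)" by (rule I.rcos_ring_hom)
  have primeJ: "primeideal (J i) (R Quot I)" if i: "i \<le> m" for i
  proof (rule primeidealI[OF idJ[OF i]])
    show "cring (R Quot I)" by (rule I.quotient_is_cring[OF is_cring])
    have "\<one>\<^bsub>R\<^esub> \<notin> P i"
      using primeideal.I_notcarr[OF prime[OF i]] ideal.one_imp_carrier[OF idP[OF i]] by blast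
    then show "carrier (R Quot I) \<noteq> J i"
      using mem[OF i one_closed] ring_hom_closed[OF hom one_closed] by blast
    fix a b assume "a \<in> carrier (R Quot I)" "b \<in> carrier (R Quot I)" and ab: "a \<otimes>\<^bsub>R Quot I\<^esub> b \<in> J i"
    then obtain c d where cd: "c \<in> carrier R" "a = I +>\<^bsub>R\<^esub> c" "d \<in> carrier R" "b = I +>\<^bsub>R\<^esub> d"
      using car by metis
    then have "I +>\<^bsub>R\<^esub> (c \<otimes>\<^bsub>R\<^esub> d) \<in> J i" using ab ring_hom_mult[OF hom cd(1,3)] by simp
    then have "c \<otimes>\<^bsub>R\<^esub> d \<in> P i" using mem[OF i] cd by simp
    then have "c \<in> P i \<or> d \<in> P i" using primeideal.I_prime[OF prime[OF i]] cd by blast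
    then show "a \<in> J i \<or> b \<in> J i" using mem[OF i] cd by blast
  qed
  have "J i \<subset> J (Suc i)" if "i < m" for i
  proof -
    have "J i \<subseteq> J (Suc i)" using strict[OF that] by (auto simp: J_def)
    moreover have "J i \<noteq> J (Suc i)"
    proof
      assume "J i = J (Suc i)"
      then have "P i = P (Suc i)"
        unfolding J_def using that idP sub
        by (intro inj_onD[OF bij_betw_imp_inj_on[OF bij]]) auto
      then show False using strict[OF that] by simp
    qed
    ultimately show ?thesis by blast
  qed
  then show ?thesis
    unfolding krull_dim_def using primeJ by (intro SUP_upper) (auto intro!: exI[of _ J])
qed

text \<open>An ultrafilter read as the quantifier "for almost all". In this form an iterated limit
  is a nesting of quantifiers.\<close>

definition ultra_quantifier :: "(('a \<Rightarrow> bool) \<Rightarrow> bool) \<Rightarrow> bool" where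
  "ultra_quantifier Q \<longleftrightarrow>
     (\<forall>P R. Q (\<lambda>x. P x \<and> R x) \<longleftrightarrow> Q P \<and> Q R) \<and> (\<forall>P. Q (\<lambda>x. \<not> P x) \<longleftrightarrow> \<not> Q P)"

lemma ultra_quantifier_conj: "ultra_quantifier Q \<Longrightarrow> Q (\<lambda>x. P x \<and> R x) \<longleftrightarrow> Q P \<and> Q R"
  and ultra_quantifier_not: "ultra_quantifier Q \<Longrightarrow> Q (\<lambda>x. \<not> P x) \<longleftrightarrow> \<not> Q P"
  by (simp_all add: ultra_quantifier_def)

lemma ultra_quantifier_mono:
  assumes "ultra_quantifier Q" "Q P" "\<And>x. P x \<Longrightarrow> R x" shows "Q R"
proof -
  have "(\<lambda>x. P x \<and> R x) = P" using assms(3) by auto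
  then show ?thesis using ultra_quantifier_conj[OF assms(1), of P R] assms(2) by simp
qed

lemma ultra_quantifier_disj:
  assumes "ultra_quantifier Q" shows "Q (\<lambda>x. P x \<or> R x) \<longleftrightarrow> Q P \<or> Q R"
proof -
  have "(\<lambda>x. P x \<or> R x) = (\<lambda>x. \<not> (\<not> P x \<and> \<not> R x))" by auto
  then show ?thesis by (simp only: ultra_quantifier_not[OF assms] ultra_quantifier_conj[OF assms]) simp
qed

lemma ultra_quantifier_True: "ultra_quantifier Q \<Longrightarrow> Q (\<lambda>x. True)"
  using ultra_quantifier_disj[of Q "\<lambda>_. True" "\<lambda>_. False"] ultra_quantifier_not[of Q "\<lambda>_. True"] by auto

text \<open>A product vanishes at a point if and only if a factor does, and the quantifier commutes
  with disjunction.\<close>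

lemma primeideal_ultra:
  fixes \<xi> :: "'v \<Rightarrow> (complex, 'n::finite) vec"
  assumes Q: "ultra_quantifier Q"
  shows "primeideal {f. holomorphic_near_0 f \<and> Q (\<lambda>z. f (\<xi> z) = 0)} holomorphic_ring"
proof -
  interpret cring "holomorphic_ring :: ((complex, 'n) vec \<Rightarrow> complex) ring"
    by (rule cring_holomorphic_ring)
  let ?R = "holomorphic_ring :: ((complex, 'n) vec \<Rightarrow> complex) ring"
  let ?P = "{f. holomorphic_near_0 f \<and> Q (\<lambda>z. f (\<xi> z) = 0)}"
  note mono = ultra_quantifier_mono[OF Q]
  have minus_closed: "holomorphic_near_0 (\<lambda>z. - f z)" if "holomorphic_near_0 f"
    for f :: "(complex, 'n) vec \<Rightarrow> complex"
    using holomorphic_near_0_mult[OF holomorphic_near_0_const[of "-1"] that] by simp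
  have minus: "\<ominus>\<^bsub>?R\<^esub> f = (\<lambda>z. - f z)" if "holomorphic_near_0 f" for f :: "(complex, 'n) vec \<Rightarrow> complex"
    using minus_closed[OF that] that by (intro minus_equality) (auto simp: holomorphic_ring_def)
  show ?thesis
  proof (rule primeidealI2)
    show "additive_subgroup ?P ?R"
    proof (rule additive_subgroup.intro, rule add.subgroupI)
      show "?P \<noteq> {}" using holomorphic_near_0_const[of 0] ultra_quantifier_True[OF Q] by auto
      fix f g assume f: "f \<in> ?P"
      then show "\<ominus>\<^bsub>?R\<^esub> f \<in> ?P" by (simp add: minus minus_closed)
      assume g: "g \<in> ?P"
      have "Q (\<lambda>z. f (\<xi> z) = 0 \<and> g (\<xi> z) = 0)" using f g by (simp add: ultra_quantifier_conj[OF Q])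
      then have "Q (\<lambda>z. f (\<xi> z) + g (\<xi> z) = 0)" by (rule mono) simp
      then show "f \<oplus>\<^bsub>?R\<^esub> g \<in> ?P" using f g by (simp add: holomorphic_ring_def holomorphic_near_0_add)
    qed (auto simp: holomorphic_ring_def)
    show "cring ?R" by (rule is_cring)
    fix f g assume "f \<in> ?P" "g \<in> carrier ?R"
    then have *: "holomorphic_near_0 f" "holomorphic_near_0 g" "Q (\<lambda>z. f (\<xi> z) = 0)"
      by (auto simp: holomorphic_ring_def)
    have "Q (\<lambda>z. g (\<xi> z) * f (\<xi> z) = 0)" "Q (\<lambda>z. f (\<xi> z) * g (\<xi> z) = 0)"
      by (rule mono[OF *(3)], simp)+
    then show "g \<otimes>\<^bsub>?R\<^esub> f \<in> ?P" "f \<otimes>\<^bsub>?R\<^esub> g \<in> ?P"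
      using * by (simp_all add: holomorphic_ring_def holomorphic_near_0_mult)
  next
    define u where "u = (\<lambda>_ :: (complex, 'n) vec. 1 :: complex)"
    have "u \<notin> ?P"
      using ultra_quantifier_not[OF Q, of "\<lambda>_. True"] ultra_quantifier_True[OF Q] by (simp add: u_def)
    moreover have "u \<in> carrier ?R" by (simp add: u_def holomorphic_ring_def holomorphic_near_0_const)
    ultimately show "carrier ?R \<noteq> ?P" by blast
  next
    fix f g assume "f \<in> carrier ?R" "g \<in> carrier ?R" "f \<otimes>\<^bsub>?R\<^esub> g \<in> ?P"
    then show "f \<in> ?P \<or> g \<in> ?P"
      by (auto simp: holomorphic_ring_def ultra_quantifier_disj[OF Q])
  qed
qed

lemma holomorphic_near_0_continuous:
  assumes "holomorphic_near_0 f"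
  obtains \<eta> where "\<eta> > 0" "\<And>x. norm x < \<eta> \<Longrightarrow> isCont f x"
proof -
  obtain U where U: "open U" "0 \<in> U" "\<forall>z\<in>U. complex_differentiable_at f z"
    using assms by (auto simp: holomorphic_near_0_def)
  then obtain \<eta> where "\<eta> > 0" "ball 0 \<eta> \<subseteq> U" using open_contains_ball by blast
  moreover from this have "isCont f x" if "norm x < \<eta>" for x
    using U(3) that has_derivative_continuous unfolding complex_differentiable_at_def
    by (metis mem_ball_0 subsetD)
  ultimately show ?thesis using that by blast
qed

lemma holomorphic_near_0_linear_coord:
  assumes "clinear_map L" shows "holomorphic_near_0 (\<lambda>x. L x $ i)"
proof -
  have "bounded_linear (\<lambda>x. L x $ i)"
    using bounded_linear_compose[OF bounded_linear_vec_nth clinear_map_bounded_linear[OF assms]] .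
  then show ?thesis
    unfolding holomorphic_near_0_def complex_differentiable_at_def
    using assms by (intro exI[of _ UNIV]) (auto intro!: exI[of _ "\<lambda>x. L x $ i"] bounded_linear_imp_has_derivative simp: clinear_map_smult)
qed

text \<open>If \<open>X\<close> is finite over \<open>\<complex>\<^sup>k\<close> near the origin, letting the coordinates of \<open>\<complex>\<^sup>k\<close> tend to \<open>0\<close> one
  after the other along an ultrafilter gives points of \<open>X\<close> over generic points of a flag. The germs
  vanishing at ultrafilter-many of these points form a prime ideal, and the flag gives a chain.\<close>

lemma germ_dim_ge:
  fixes X :: "(complex, 'n::finite) vec set" and A :: "(complex, 'm::finite) vec \<Rightarrow> (complex, 'n) vec"
    and \<kappa> :: "nat \<Rightarrow> 'm"
  assumes A: "clinear_map A" and A': "clinear_map A'" and A'A: "\<And>x. A' (A x) = x"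
    and \<kappa>: "inj_on \<kappa> {..<k}"
    and C: "compact C" "\<And>x. x \<in> C \<Longrightarrow> A x \<in> X" "\<And>x. x \<in> C \<Longrightarrow> (\<forall>m<k. x $ \<kappa> m = 0) \<Longrightarrow> x = 0"
    and \<delta>: "\<delta> > 0" and onto: "\<And>z. norm z < \<delta> \<Longrightarrow> (\<forall>l. l \<notin> \<kappa> ` {..<k} \<longrightarrow> z $ l = 0) \<Longrightarrow>
      \<exists>x\<in>C. \<forall>m<k. x $ \<kappa> m = z $ \<kappa> m"
  shows "enat k \<le> germ_dim X"
proof -
  \<comment> \<open>The ultrafilter lives on the punctured plane: parameters tend to 0, which gives
    inclusions of primes, but are nonzero, which gives strictness.\<close>
  have "at (0::complex) \<noteq> bot" by simp
  from ex_ultrafilter[OF this] obtain U where U: "U \<le> at (0::complex)" "U \<noteq> bot"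
    and ultra: "\<And>P. eventually P U \<or> eventually (\<lambda>x. \<not> P x) U" by blast
  have Unot: "eventually (\<lambda>x. \<not> P x) U \<longleftrightarrow> \<not> eventually P U" for P
    using ultra[of P] U(2) eventually_conj[of P U "\<lambda>x. \<not> P x"] by (auto simp: eventually_False)
  have Une: "eventually (\<lambda>s. s \<noteq> 0) U"
    using U(1) by (rule filter_leD) (simp add: eventually_at_filter)
  have Ulim: "((\<lambda>s. s) \<longlongrightarrow> 0) U"
    using U(1) by (rule tendsto_mono) (rule tendsto_ident_at)
  have axlim: "((\<lambda>s. z + axis i s) \<longlongrightarrow> z) U" for z :: "(complex, 'm) vec" and i
  proof -
    have "continuous_on UNIV (\<lambda>s. z + axis i s)" by (intro continuous_intros)
    then have "isCont (\<lambda>s. z + axis i s) 0" by (simp add: continuous_on_eq_continuous_at)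
    from isCont_tendsto_compose[OF this Ulim] show ?thesis by simp
  qed
  \<comment> \<open>The flag: near 0, the span of the first \<open>m\<close> chosen
    coordinates.\<close>
  define D where "D = (\<lambda>m. {z :: (complex, 'm) vec. norm z < \<delta> \<and> (\<forall>l. l \<notin> \<kappa> ` {..<m} \<longrightarrow> z $ l = 0)})"
  have Dstep: "eventually (\<lambda>s. z + axis (\<kappa> m) s \<in> D (Suc m)) U" if "z \<in> D m" for z m
  proof -
    have "eventually (\<lambda>s. norm (z + axis (\<kappa> m) s) < \<delta>) U"
      using that tendsto_norm[OF axlim[of z "\<kappa> m"]] by (intro order_tendstoD(2)) (auto simp: D_def)
    then show ?thesis
      by (rule eventually_mono) (use that in \<open>auto simp: D_def axis_def lessThan_Suc\<close>)
  qed

  \<comment> \<open>Almost all points of the \<open>m\<close>-th stratum. The last coordinate is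
    quantified innermost, so it tends to 0 while the earlier ones stay fixed.\<close>
  define Q where "Q = rec_nat (\<lambda>P. P 0)
    (\<lambda>m q P. q (\<lambda>z :: (complex, 'm) vec. eventually (\<lambda>s. P (z + axis (\<kappa> m) s)) U))"
  have Q0: "Q 0 P \<longleftrightarrow> P 0" and QSuc: "Q (Suc m) P \<longleftrightarrow> Q m (\<lambda>z. eventually (\<lambda>s. P (z + axis (\<kappa> m) s)) U)" for m P
    by (simp_all add: Q_def)
  have Q: "ultra_quantifier (Q m)" for m
  proof (induction m)
    case (Suc m)
    then show ?case by (simp add: ultra_quantifier_def QSuc eventually_conj_iff Unot)
  qed (simp add: ultra_quantifier_def Q0)
  note Qmono = ultra_quantifier_mono[OF Q]
  have QD: "Q m (\<lambda>z. z \<in> D m)" for m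
  proof (induction m)
    case (Suc m)
    from Qmono[OF this Dstep] show ?case by (simp add: QSuc)
  qed (simp add: Q0 D_def \<delta>)

  define over where "over = (\<lambda>z x. x \<in> C \<and> (\<forall>l<k. x $ \<kappa> l = z $ \<kappa> l))"
  \<comment> \<open>On a compact set an ultrafilter converges, and the limit of the lifts lies over
    the limit of the base points.\<close>
  have limit: "\<exists>x. over z x \<and> ((\<lambda>s. y (z + axis (\<kappa> m) s)) \<longlongrightarrow> x) U"
    if z: "z \<in> D m" and y: "\<And>z. z \<in> D (Suc m) \<Longrightarrow> over z (y z)" for m z y
  proof -
    define G where "G = filtermap (\<lambda>s. y (z + axis (\<kappa> m) s)) U"
    have ev: "eventually (\<lambda>s. over (z + axis (\<kappa> m) s) (y (z + axis (\<kappa> m) s))) U"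
      using Dstep[OF z] by (rule eventually_mono) (rule y)
    then have "eventually (\<lambda>x. x \<in> C) G"
      unfolding G_def eventually_filtermap by (rule eventually_mono) (simp add: over_def)
    moreover have "G \<noteq> bot" using U(2) by (simp add: G_def filtermap_bot_iff)
    ultimately obtain x where x: "x \<in> C" "inf (nhds x) G \<noteq> bot"
      using C(1) unfolding compact_filter by blast
    have lim: "((\<lambda>s. y (z + axis (\<kappa> m) s)) \<longlongrightarrow> x) U"
      unfolding filterlim_def G_def[symmetric]
    proof (rule filter_leI)
      fix P assume P: "eventually P (nhds x)"
      show "eventually P G"
      proof (rule ccontr)
        assume "\<not> eventually P G"
        then have "eventually (\<lambda>x. \<not> P x) G" by (simp add: G_def eventually_filtermap Unot)
        with P have "eventually (\<lambda>x. False) (inf (nhds x) G)"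
          unfolding eventually_inf by (intro exI[of _ P] exI[of _ "\<lambda>x. \<not> P x"]) auto
        then show False using x(2) by (simp add: eventually_False)
      qed
    qed
    have "x $ \<kappa> l = z $ \<kappa> l" if l: "l < k" for l
    proof (rule tendsto_unique[OF U(2)])
      show "((\<lambda>s. y (z + axis (\<kappa> m) s) $ \<kappa> l) \<longlongrightarrow> x $ \<kappa> l) U"
        by (rule tendsto_vec_nth[OF lim])
      have "((\<lambda>s. (z + axis (\<kappa> m) s) $ \<kappa> l) \<longlongrightarrow> z $ \<kappa> l) U" by (rule tendsto_vec_nth[OF axlim])
      then show "((\<lambda>s. y (z + axis (\<kappa> m) s) $ \<kappa> l) \<longlongrightarrow> z $ \<kappa> l) U"
        by (rule Lim_transform_eventually) (use ev l in \<open>auto elim!: eventually_mono simp: over_def\<close>)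
    qed
    then show ?thesis using x(1) lim by (auto simp: over_def)
  qed
  \<comment> \<open>Lifts are chosen from the largest stratum downwards, each as a limit of lifts
    from the next larger one. The index of \<open>\<eta>\<close> counts from the top, that of
    \<open>\<xi>\<close> from the bottom.\<close>
  define top where "top = (\<lambda>z. SOME x. over z x)"
  define \<eta> where "\<eta> = rec_nat top (\<lambda>j y z. SOME x. over z x \<and>
      ((\<lambda>s. y (z + axis (\<kappa> (k - Suc j)) s)) \<longlongrightarrow> x) U)"
  define \<xi> where "\<xi> = (\<lambda>m. \<eta> (k - m))"
  have \<eta>: "\<forall>z\<in>D (k - j). over z (\<eta> j z) \<and>
      (j > 0 \<longrightarrow> ((\<lambda>s. \<eta> (j - 1) (z + axis (\<kappa> (k - j)) s)) \<longlongrightarrow> \<eta> j z) U)" if "j \<le> k" for j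
    using that
  proof (induction j)
    case 0
    have "\<exists>x. over z x" if "z \<in> D k" for z using onto[of z] that by (auto simp: over_def D_def)
    then show ?case by (auto simp: \<eta>_def top_def intro: someI_ex)
  next
    case (Suc j)
    have eq: "k - j = Suc (k - Suc j)" using Suc.prems by simp
    have "over z (\<eta> (Suc j) z) \<and> ((\<lambda>s. \<eta> j (z + axis (\<kappa> (k - Suc j)) s)) \<longlongrightarrow> \<eta> (Suc j) z) U"
      if "z \<in> D (k - Suc j)" for z
      using someI_ex[OF limit[OF that, of "\<eta> j"]] Suc unfolding eq by (simp add: \<eta>_def)
    then show ?case by simp
  qed
  have over: "over z (\<xi> m z)" if "m \<le> k" "z \<in> D m" for m z
    using \<eta>[of "k - m"] that by (simp add: \<xi>_def)
  have lim: "((\<lambda>s. \<xi> (Suc m) (z + axis (\<kappa> m) s)) \<longlongrightarrow> \<xi> m z) U" if "m < k" "z \<in> D m" for m z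
    using \<eta>[of "k - m"] that by (auto simp: \<xi>_def)
  \<comment> \<open>Germs can only be evaluated near 0. The lift of 0 is 0, and smallness passes up
    the flag by convergence.\<close>
  have small: "Q m (\<lambda>z. z \<in> D m \<and> norm (\<xi> m z) < e)" if "m \<le> k" "e > 0" for m e
    using that(1)
  proof (induction m)
    case 0
    have "0 \<in> D 0" using \<delta> by (simp add: D_def)
    moreover from over[OF le0 this] have "\<xi> 0 0 = 0" by (intro C(3)) (auto simp: over_def)
    ultimately show ?case using that(2) by (simp add: Q0)
  next
    case (Suc m)
    have "Q m (\<lambda>z. eventually (\<lambda>s. z + axis (\<kappa> m) s \<in> D (Suc m) \<and> norm (\<xi> (Suc m) (z + axis (\<kappa> m) s)) < e) U)"
    proof (rule Qmono[OF Suc.IH])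
      fix z assume z: "z \<in> D m \<and> norm (\<xi> m z) < e"
      have "eventually (\<lambda>s. norm (\<xi> (Suc m) (z + axis (\<kappa> m) s)) < e) U"
        using tendsto_norm[OF lim[of m z]] z Suc.prems by (intro order_tendstoD(2)) auto
      then show "eventually (\<lambda>s. z + axis (\<kappa> m) s \<in> D (Suc m) \<and> norm (\<xi> (Suc m) (z + axis (\<kappa> m) s)) < e) U"
        using Dstep[of z m] z by (simp add: eventually_conj_iff)
    qed (use Suc.prems in simp)
    then show ?case by (simp add: QSuc)
  qed
  obtain B where B: "B > 0" "\<And>x. norm (A x) \<le> norm x * B"
    using bounded_linear.pos_bounded[OF clinear_map_bounded_linear[OF A]] by blast
  have smallA: "Q m (\<lambda>z. z \<in> D m \<and> norm (A (\<xi> m z)) < e)" if "m \<le> k" "e > 0" for m e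
  proof (rule Qmono[OF small[OF that(1), of "e / B"]])
    fix z assume "z \<in> D m \<and> norm (\<xi> m z) < e / B"
    then show "z \<in> D m \<and> norm (A (\<xi> m z)) < e"
      using B(1) B(2)[of "\<xi> m z"] by (auto simp: pos_less_divide_eq)
  qed (use B(1) that in simp)

  define P where "P = (\<lambda>m. {f. holomorphic_near_0 f \<and> Q m (\<lambda>z. f (A (\<xi> m z)) = 0)})"
  have step: "P (Suc m) \<subset> P m" if m: "m < k" for m
  proof
    \<comment> \<open>Vanishing at almost all nearby lifts passes to their limit by
      continuity.\<close>
    show "P (Suc m) \<subseteq> P m"
    proof
      fix f assume "f \<in> P (Suc m)"
      then have f: "holomorphic_near_0 f" "Q m (\<lambda>z. eventually (\<lambda>s. f (A (\<xi> (Suc m) (z + axis (\<kappa> m) s))) = 0) U)"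
        by (simp_all add: P_def QSuc)
      obtain e where e: "e > 0" "\<And>x. norm x < e \<Longrightarrow> isCont f x"
        using holomorphic_near_0_continuous[OF f(1)] by blast
      have "Q m (\<lambda>z. (z \<in> D m \<and> norm (A (\<xi> m z)) < e) \<and>
          eventually (\<lambda>s. f (A (\<xi> (Suc m) (z + axis (\<kappa> m) s))) = 0) U)"
        using f(2) smallA[of m e] m e(1) by (simp add: ultra_quantifier_conj[OF Q])
      then have "Q m (\<lambda>z. f (A (\<xi> m z)) = 0)"
      proof (rule Qmono)
        fix z assume z: "(z \<in> D m \<and> norm (A (\<xi> m z)) < e) \<and>
          eventually (\<lambda>s. f (A (\<xi> (Suc m) (z + axis (\<kappa> m) s))) = 0) U"
        have "((\<lambda>s. f (A (\<xi> (Suc m) (z + axis (\<kappa> m) s)))) \<longlongrightarrow> f (A (\<xi> m z))) U"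
          using z m e(2)
          by (intro isCont_tendsto_compose[of _ f] bounded_linear.tendsto[OF clinear_map_bounded_linear[OF A]] lim) auto
        moreover have "((\<lambda>s. f (A (\<xi> (Suc m) (z + axis (\<kappa> m) s)))) \<longlongrightarrow> 0) U"
          using z by (intro tendsto_eventually) simp
        ultimately show "f (A (\<xi> m z)) = 0" using tendsto_unique[OF U(2)] by blast
      qed
      then show "f \<in> P m" using f(1) by (simp add: P_def)
    qed
    \<comment> \<open>The coordinate \<open>\<kappa> m\<close>, read off through \<open>A'\<close>,
      is 0 on the \<open>m\<close>-th stratum and equals the nonzero parameter on the next.\<close>
    define f where "f = (\<lambda>x. A' x $ \<kappa> m)"
    have f: "holomorphic_near_0 f" unfolding f_def by (rule holomorphic_near_0_linear_coord[OF A'])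
    have km: "\<kappa> m \<notin> \<kappa> ` {..<m}" using m by (auto dest!: inj_onD[OF \<kappa>])
    have fval: "f (A (\<xi> j z)) = z $ \<kappa> m" if "j \<le> k" "z \<in> D j" for j z
      using over[OF that] m by (simp add: f_def A'A over_def)
    have "Q m (\<lambda>z. f (A (\<xi> m z)) = 0)"
      by (rule Qmono[OF QD]) (use fval[of m] m km in \<open>auto simp: D_def\<close>)
    then have "f \<in> P m" using f by (simp add: P_def)
    moreover have "Q (Suc m) (\<lambda>z. f (A (\<xi> (Suc m) z)) \<noteq> 0)"
      unfolding QSuc
    proof (rule Qmono[OF QD])
      fix z assume z: "z \<in> D m"
      show "eventually (\<lambda>s. f (A (\<xi> (Suc m) (z + axis (\<kappa> m) s))) \<noteq> 0) U"
        using eventually_conj[OF Dstep[OF z] Une]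
      proof (rule eventually_mono)
        fix s assume s: "z + axis (\<kappa> m) s \<in> D (Suc m) \<and> s \<noteq> 0"
        moreover have "z $ \<kappa> m = 0" using z km by (simp add: D_def)
        ultimately show "f (A (\<xi> (Suc m) (z + axis (\<kappa> m) s))) \<noteq> 0"
          using fval[of "Suc m"] m by (simp add: axis_def)
      qed
    qed
    then have "f \<notin> P (Suc m)" by (simp add: P_def ultra_quantifier_not[OF Q])
    ultimately show "P (Suc m) \<noteq> P m" by blast
  qed
  have sub: "vanishing_ideal X \<subseteq> P m" if m: "m \<le> k" for m
  proof
    fix f assume "f \<in> vanishing_ideal X"
    then have f: "holomorphic_near_0 f" "\<forall>\<^sub>F z in nhds 0. z \<in> X \<longrightarrow> f z = 0"
      by (auto simp: vanishing_ideal_def)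
    then obtain e where e: "e > 0" "\<And>x. norm x < e \<Longrightarrow> x \<in> X \<Longrightarrow> f x = 0"
      by (auto simp: eventually_nhds_metric)
    have "Q m (\<lambda>z. f (A (\<xi> m z)) = 0)"
    proof (rule Qmono[OF smallA[OF m e(1)]])
      fix z assume z: "z \<in> D m \<and> norm (A (\<xi> m z)) < e"
      then have "A (\<xi> m z) \<in> X" using over[OF m, of z] C(2) by (simp add: over_def)
      then show "f (A (\<xi> m z)) = 0" using e(2) z by blast
    qed
    then show "f \<in> P m" using f(1) by (simp add: P_def)
  qed
  show ?thesis
    unfolding germ_dim_def local_ring_def
  \<comment> \<open>Larger strata have smaller ideals, so the index is reversed.\<close>
  proof (rule krull_dim_Quot_ge[where P = "\<lambda>i. P (k - i)"])
    show "primeideal (P (k - i)) holomorphic_ring" for i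
      unfolding P_def by (rule primeideal_ultra[OF Q])
    show "P (k - i) \<subset> P (k - Suc i)" if "i < k" for i
      using step[of "k - Suc i"] that by (simp add: Suc_diff_Suc)
  qed (use sub in \<open>auto intro: cring_holomorphic_ring ideal_vanishing_ideal\<close>)
qed

section \<open>Images of holomorphic map germs\<close>

lemma has_derivative_vec_lambda:
  fixes f :: "'i::finite \<Rightarrow> 'a::real_normed_vector \<Rightarrow> complex"
  assumes "\<And>i. (f i has_derivative f' i) F"
  shows "((\<lambda>x. \<chi> i. f i x) has_derivative (\<lambda>v. \<chi> i. f' i v)) F"
proof -
  have ax: "bounded_linear (\<lambda>t :: complex. axis i t :: (complex, 'i) vec)" for i
    by (rule bounded_linear_intro[where K = 1]) (simp_all add: norm_axis, simp_all add: vec_eq_iff axis_def)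
  have sum: "(\<Sum>i\<in>UNIV. axis i (a i)) = (\<chi> i. a i)" for a :: "'i \<Rightarrow> complex"
    by (simp add: vec_eq_iff axis_def)
  have "((\<lambda>x. \<Sum>i\<in>UNIV. axis i (f i x)) has_derivative (\<lambda>v. \<Sum>i\<in>UNIV. axis i (f' i v))) F"
    by (intro has_derivative_sum bounded_linear.has_derivative[OF ax] assms)
  then show ?thesis by (simp only: sum)
qed

text \<open>A linear projection of least possible rank that is finite on the zero set is onto: otherwise a
  nonzero function of the coordinates in \<open>K\<close> vanishes on its image, and a line on which this function
  does not vanish identically can be moved into the kernel.\<close>

lemma ex_finite_projection:
  fixes F :: "(complex, 'n::finite) vec \<Rightarrow> (complex, 'p::finite) vec"
  assumes r0: "r0 > 0" and F: "\<And>i. gholo (ball 0 r0) (\<lambda>z. F z $ i)" and F0: "F 0 = 0"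
  shows "\<exists>A A' (K :: 'n set) r. clinear_map A \<and> clinear_map A' \<and> (\<forall>x. A' (A x) = x) \<and> r > 0 \<and>
    (\<forall>x\<in>ball 0 r. F (A x) = 0 \<longrightarrow> (\<forall>i\<in>K. x $ i = 0) \<longrightarrow> x = 0) \<and>
    enat (card K) \<le> germ_dim {z. F z = 0}"
proof -
  define P where "P = (\<lambda>k. \<exists>A A' (K :: 'n set) r. clinear_map A \<and> clinear_map A' \<and> (\<forall>x. A' (A x) = x) \<and>
    r > 0 \<and> (\<forall>x\<in>ball 0 r. F (A x) = 0 \<longrightarrow> (\<forall>i\<in>K. x $ i = 0) \<longrightarrow> x = 0) \<and> card K = k)"
  have "P (CARD('n))"
    unfolding P_def
    by (intro exI[of _ "\<lambda>x. x"] exI[of _ UNIV] exI[of _ 1]) (auto simp: clinear_map_def vec_eq_iff)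
  then have "P (LEAST k. P k)" by (rule LeastI)
  then obtain A A' and K :: "'n set" and r where A: "clinear_map A" "clinear_map A'" "\<And>x. A' (A x) = x"
    and r: "r > 0" "\<And>x. x \<in> ball 0 r \<Longrightarrow> F (A x) = 0 \<Longrightarrow> (\<forall>i\<in>K. x $ i = 0) \<Longrightarrow> x = 0"
    and K: "card K = (LEAST k. P k)"
    unfolding P_def by blast
  obtain s0 where s0: "s0 > 0" "\<And>x. x \<in> ball 0 s0 \<Longrightarrow> A x \<in> ball 0 r0"
    using clinear_map_small[OF A(1) r0] by blast
  define s where "s = min s0 r"
  have s: "s > 0" "s \<le> r" "\<And>x. x \<in> ball 0 s \<Longrightarrow> A x \<in> ball 0 r0"
    using s0 r(1) by (auto simp: s_def)
  have FA: "gholo (ball 0 s) (\<lambda>x. F (A x) $ i)" for i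
    by (rule gholo_compose_linear[OF A(1) F s(3)])
  define X where "X = {x. F (A x) = 0}"
  have "analytic_in s X"
    unfolding analytic_in_def
  proof (intro ballI impI)
    fix z assume "z \<notin> X"
    then obtain i where "F (A z) $ i \<noteq> 0" by (auto simp: X_def vec_eq_iff)
    then show "\<exists>f. gholo (ball 0 s) f \<and> (\<forall>x\<in>X \<inter> ball 0 s. f x = 0) \<and> f z \<noteq> 0"
      using FA[of i] by (intro exI[of _ "\<lambda>x. F (A x) $ i"]) (auto simp: X_def)
  qed
  then have "\<exists>d Y. 0 < d \<and> d \<le> s / 2 \<and> analytic_in d Y \<and>
    (\<forall>z\<in>Y \<inter> ball 0 d. \<exists>x\<in>X \<inter> ball 0 (s / 2). \<forall>i. i \<notin> - K \<longrightarrow> x $ i = z $ i) \<and>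
    (\<forall>x\<in>X \<inter> ball 0 d. zero_on (- K) x \<in> Y)"
    by (intro analytic_in_project[where r = s]) (use s r in \<open>auto simp: X_def\<close>)
  then obtain d Y where d: "0 < d" "d \<le> s / 2" and Y: "analytic_in d Y"
    and a: "\<forall>z\<in>Y \<inter> ball 0 d. \<exists>x\<in>X \<inter> ball 0 (s / 2). \<forall>i. i \<notin> - K \<longrightarrow> x $ i = z $ i"
    and b: "\<forall>x\<in>X \<inter> ball 0 d. zero_on (- K) x \<in> Y" by blast
  have "\<forall>z\<in>ball 0 d. (\<forall>l. l \<notin> K \<longrightarrow> z $ l = 0) \<longrightarrow> z \<in> Y"
  proof (rule ccontr)
    assume "\<not> ?thesis"
    then obtain v where v: "norm v < d" "\<And>l. l \<notin> K \<Longrightarrow> v $ l = 0" "v \<notin> Y" by auto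
    then obtain \<psi> where \<psi>: "gholo (ball 0 d) \<psi>" "\<forall>x\<in>Y \<inter> ball 0 d. \<psi> x = 0" "\<psi> v \<noteq> 0"
      using Y unfolding analytic_in_def by auto
    have Y0: "0 \<in> Y"
    proof -
      have "0 \<in> X" using F0 by (simp add: X_def clinear_map_zero[OF A(1)])
      then have "zero_on (- K) 0 \<in> Y" using b d by simp
      moreover have "zero_on (- K) 0 = 0" by (simp add: vec_eq_iff)
      ultimately show ?thesis by simp
    qed
    have "v \<noteq> 0" using Y0 v(3) by auto
    then obtain i where i: "v $ i \<noteq> 0" "i \<in> K" using v(2) by (auto simp: vec_eq_iff)
    have "\<psi> 0 = 0" using \<psi>(2) Y0 d by simp
    from nonzero_on_line[OF \<psi>(1) this \<psi>(3) v(1)] obtain \<sigma> where \<sigma>: "0 < \<sigma>"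
      "\<And>t. 0 < cmod t \<Longrightarrow> cmod t < \<sigma> \<Longrightarrow> \<psi> (t *s v) \<noteq> 0" by blast
    \<comment> \<open>\<open>T\<close> sends the \<open>i\<close>-th axis vector to \<open>v\<close>
      and fixes the others, and \<open>T'\<close> inverts it. The kernel of the projection to
      \<open>K - {i}\<close> then contains the direction \<open>v\<close>.\<close>
    define w where "w = v - axis i 1"
    define T where "T = (\<lambda>x :: (complex, 'n) vec. x + (x $ i) *s w)"
    define T' where "T' = (\<lambda>x :: (complex, 'n) vec. x - (x $ i / v $ i) *s w)"
    have T: "clinear_map T" "clinear_map T'"
      by (auto intro!: clinear_mapI simp: T_def T'_def vec_eq_iff algebra_simps add_divide_distrib)
    have T'T: "T' (T x) = x" for x
    proof -
      have "T x $ i = x $ i * v $ i" by (simp add: T_def w_def algebra_simps axis_def)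
      then have "T' (T x) = T x - (x $ i) *s w" using i(1) by (simp add: T'_def)
      then show ?thesis by (simp add: T_def)
    qed
    have "min (min d \<sigma>) s > 0" using d \<sigma> s by simp
    from clinear_map_small[OF T(1) this] obtain e where
      e: "e > 0" "\<And>x. x \<in> ball 0 e \<Longrightarrow> T x \<in> ball 0 (min (min d \<sigma>) s)" by blast
    have "P (card (K - {i}))"
      unfolding P_def
    proof (rule exI[of _ "\<lambda>x. A (T x)"], rule exI[of _ "\<lambda>x. T' (A' x)"], rule exI[of _ "K - {i}"],
        rule exI[of _ "min e \<sigma>"], intro conjI allI ballI impI)
      show "clinear_map (\<lambda>x. A (T x))" by (rule clinear_map_compose[OF A(1) T(1)])
      show "clinear_map (\<lambda>x. T' (A' x))" by (rule clinear_map_compose[OF T(2) A(2)])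
      show "T' (A' (A (T x))) = x" for x by (simp add: A(3) T'T)
      show "min e \<sigma> > 0" using e \<sigma> by simp
      fix x assume x: "x \<in> ball 0 (min e \<sigma>)" "F (A (T x)) = 0" "\<forall>l\<in>K - {i}. x $ l = 0"
      have TX: "T x \<in> X" "T x \<in> ball 0 d" "T x \<in> ball 0 s" using x(1,2) e(2)[of x] by (auto simp: X_def)
      \<comment> \<open>A zero in the new kernel projects onto the line through \<open>v\<close>,
        where \<open>\<psi>\<close> vanishes only at the origin.\<close>
      have zT: "zero_on (- K) (T x) = (x $ i) *s v"
        using x(3) v(2) by (auto simp: vec_eq_iff T_def w_def axis_def algebra_simps)
      have "(x $ i) *s v \<in> Y" "(x $ i) *s v \<in> ball 0 d"
        using b TX norm_zero_on_le[of "- K" "T x"] by (auto simp flip: zT)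
      then have "\<psi> ((x $ i) *s v) = 0" using \<psi>(2) by blast
      moreover have "cmod (x $ i) < \<sigma>"
        using Finite_Cartesian_Product.norm_nth_le[where x = x and i = i] x(1) by simp
      ultimately have xi: "x $ i = 0" using \<sigma>(2)[of "x $ i"] by force
      then have "T x = x" by (simp add: T_def)
      then show "x = 0" using r(2)[of x] TX s(2) x xi by auto
    qed simp
    then have "(LEAST k. P k) \<le> card (K - {i})" by (rule Least_le)
    moreover have "card (K - {i}) < card K" using i(2) by (intro psubset_card_mono) auto
    ultimately show False using K by simp
  qed
  note onto = this
  obtain \<kappa> where \<kappa>: "bij_betw \<kappa> {..<card K} K"
    using ex_bij_betw_nat_finite[of K] by (auto simp: atLeast0LessThan)
  have \<kappa>K: "\<kappa> ` {..<card K} = K" using \<kappa> by (simp add: bij_betw_def)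
  \<comment> \<open>Half the radius keeps the closed ball inside the domain, so that
    \<open>C\<close> is compact.\<close>
  define C where "C = cball 0 (s / 2) \<inter> X"
  have "enat (card K) \<le> germ_dim {z. F z = 0}"
  proof (rule germ_dim_ge[OF A(1,2,3), where \<kappa> = \<kappa> and C = C and \<delta> = d])
    show "inj_on \<kappa> {..<card K}" using \<kappa> by (simp add: bij_betw_def)
    have "continuous_on (ball 0 s) (\<lambda>x. F (A x))" by (rule gholo_imp_continuous_vec[OF FA])
    then have "continuous_on (cball 0 (s / 2)) (\<lambda>x. F (A x))"
      by (rule continuous_on_subset) (use s in auto)
    from continuous_closed_preimage[OF this closed_cball closed_singleton[of 0]]
    have "closed C" by (simp add: C_def X_def vimage_def)
    then show "compact C" unfolding compact_eq_bounded_closed by (auto simp: C_def intro: bounded_subset)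
    show "A x \<in> {z. F z = 0}" if "x \<in> C" for x using that by (simp add: C_def X_def)
    show "x = 0" if "x \<in> C" "\<forall>m<card K. x $ \<kappa> m = 0" for x
    proof (rule r(2))
      show "x \<in> ball 0 r" "F (A x) = 0" using that(1) s by (auto simp: C_def X_def)
      show "\<forall>i\<in>K. x $ i = 0"
      proof
        fix i assume "i \<in> K"
        then obtain m where "m < card K" "i = \<kappa> m" using \<kappa>K by (metis imageE lessThan_iff)
        then show "x $ i = 0" using that(2) by simp
      qed
    qed
    fix z :: "(complex, 'n) vec" assume z: "norm z < d" "\<forall>l. l \<notin> \<kappa> ` {..<card K} \<longrightarrow> z $ l = 0"
    then have "z \<in> Y \<inter> ball 0 d" using onto unfolding \<kappa>K by simp
    then obtain x where "x \<in> X \<inter> ball 0 (s / 2)" "\<forall>i. i \<notin> - K \<longrightarrow> x $ i = z $ i" using a by blast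
    then show "\<exists>x\<in>C. \<forall>m<card K. x $ \<kappa> m = z $ \<kappa> m"
      using \<kappa>K by (intro bexI[of _ x]) (auto simp: C_def)
  qed (rule d(1))
  then show ?thesis using A r by blast
qed

text \<open>Setting the coordinates in \<open>K\<close> to 0 leaves at least as many free ones as
  there are target coordinates.\<close>

lemma image_contains_ball:
  fixes F :: "(complex, 'n::finite) vec \<Rightarrow> (complex, 'p::finite) vec"
  assumes pn: "CARD('p) \<le> CARD('n)" and r0: "r0 > 0" and F: "\<And>i. gholo (ball 0 r0) (\<lambda>z. F z $ i)"
    and F0: "F 0 = 0" and dim: "germ_dim {z. F z = 0} \<le> enat (CARD('n) - CARD('p))" and \<epsilon>: "\<epsilon> > 0"
  shows "\<exists>\<delta>>0. ball 0 \<delta> \<subseteq> F ` ball 0 \<epsilon>"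
proof -
  obtain A A' and K :: "'n set" and r where A: "clinear_map A" "clinear_map A'" "\<And>x. A' (A x) = x"
    and r: "r > 0" "\<And>x. x \<in> ball 0 r \<Longrightarrow> F (A x) = 0 \<Longrightarrow> (\<forall>i\<in>K. x $ i = 0) \<Longrightarrow> x = 0"
    and K: "enat (card K) \<le> germ_dim {z. F z = 0}"
    using ex_finite_projection[OF r0 F F0] by blast
  have "card K \<le> CARD('n) - CARD('p)" using order_trans[OF K dim] by simp
  then have "CARD('p) \<le> card (- K)" using pn by (simp add: Compl_eq_Diff_UNIV card_Diff_subset)
  then obtain M where M: "M \<subseteq> - K" "card M = CARD('p)" by (rule obtain_subset_with_card_n)
  then obtain h where h: "bij_betw h (UNIV :: 'p set) M"
    by (metis finite finite_same_card_bij)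
  define h' where "h' = inv_into UNIV h"
  have h'h: "h' (h j) = j" for j using h by (simp add: h'_def bij_betw_def)
  \<comment> \<open>Embeds the target dimension as the coordinate subspace indexed by
    \<open>M\<close>; \<open>h'\<close> is only evaluated on \<open>M\<close>, where it inverts
    \<open>h\<close>.\<close>
  define \<iota> where "\<iota> = (\<lambda>y :: (complex, 'p) vec. \<chi> l. if l \<in> M then y $ h' l else 0)"
  have \<iota>: "clinear_map \<iota>" by (rule clinear_mapI) (auto simp: \<iota>_def vec_eq_iff)
  have \<iota>h: "\<iota> y $ h j = y $ j" for y j
    using h h'h[of j] by (auto simp: \<iota>_def bij_betw_def)
  define B where "B = (\<lambda>y. A (\<iota> y))"
  have B: "clinear_map B" unfolding B_def by (rule clinear_map_compose[OF A(1) \<iota>])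
  obtain s1 where s1: "s1 > 0" "\<And>y. y \<in> ball 0 s1 \<Longrightarrow> B y \<in> ball 0 r0"
    using clinear_map_small[OF B r0] by blast
  obtain s2 where s2: "s2 > 0" "\<And>y. y \<in> ball 0 s2 \<Longrightarrow> \<iota> y \<in> ball 0 r"
    using clinear_map_small[OF \<iota> r(1)] by blast
  obtain e where e: "e > 0" "\<And>y. y \<in> ball 0 e \<Longrightarrow> B y \<in> ball 0 \<epsilon>"
    using clinear_map_small[OF B \<epsilon>] by blast
  have "\<exists>\<delta>>0. ball 0 \<delta> \<subseteq> (\<lambda>y. F (B y)) ` ball 0 e"
  proof (rule open_at_isolated_zero[where r = "min s1 s2"])
    show "gholo (ball 0 (min s1 s2)) (\<lambda>y. F (B y) $ i)" for i
      by (rule gholo_compose_linear[OF B F]) (use s1 in auto)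
    show "F (B 0) = 0" by (simp add: clinear_map_zero[OF B] F0)
    fix y assume y: "y \<in> ball 0 (min s1 s2)" "F (B y) = 0"
    have "\<iota> y = 0"
    proof (rule r(2))
      show "\<iota> y \<in> ball 0 r" using y(1) s2(2) by simp
      show "F (A (\<iota> y)) = 0" using y(2) by (simp add: B_def)
      show "\<forall>i\<in>K. \<iota> y $ i = 0" using M(1) by (auto simp: \<iota>_def)
    qed
    then have "y $ j = 0" for j using \<iota>h[of y j] by simp
    then show "y = 0" by (simp add: vec_eq_iff)
  qed (use s1 s2 e in auto)
  then obtain \<delta> where "\<delta> > 0" "ball 0 \<delta> \<subseteq> (\<lambda>y. F (B y)) ` ball 0 e" by blast
  then show ?thesis using e(2) by (intro exI[of _ \<delta>]) blast
qed

section \<open>Rank of the Jacobian and the singular locus\<close>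

text \<open>Right invertibility means independence of the rows as a family, while the rank sees the
  set \<open>rows A\<close>. Both directions therefore first exclude repeated rows.\<close>

lemma right_invertible_iff_rank:
  fixes A :: "complex ^ 'n::finite ^ 'm::finite"
  shows "(\<exists>B. A ** B = mat 1) \<longleftrightarrow> \<not> rank A < CARD('m)"
proof -
  have rows: "rows A = range (\<lambda>i. row i A)" by (auto simp: rows_def)
  have reindex: "(\<Sum>i\<in>UNIV. f (row i A) *s row i A) = (\<Sum>v\<in>rows A. f v *s v)"
    if "inj (\<lambda>i. row i A)" for f
    unfolding rows using that by (simp add: sum.reindex)
  show ?thesis
    unfolding matrix_right_invertible_independent_rows
  proof
    assume indep: "\<forall>c. (\<Sum>i\<in>UNIV. c i *s row i A) = 0 \<longrightarrow> (\<forall>i. c i = 0)"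
    have inj: "inj (\<lambda>i. row i A)"
    proof (rule injI, rule ccontr)
      fix i j assume eq: "row i A = row j A" "i \<noteq> j"
      define c where "c = (\<lambda>k. if k = i then 1 else if k = j then - 1 else 0 :: complex)"
      have "(\<Sum>k\<in>UNIV. c k *s row k A) = (\<Sum>k\<in>{i, j}. c k *s row k A)"
        by (rule sum.mono_neutral_right) (auto simp: c_def)
      also have "\<dots> = 0" using eq by (simp add: c_def vec_eq_iff)
      finally have "c i = 0" using indep by blast
      then show False by (simp add: c_def)
    qed
    have "vec.independent (rows A)"
    proof (rule vec.independent_if_scalars_zero)
      show "finite (rows A)" by (simp add: rows)
      fix f v assume "(\<Sum>v\<in>rows A. f v *s v) = 0" "v \<in> rows A"
      then show "f v = 0" using indep reindex[OF inj, of f] by (auto simp: rows)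
    qed
    then have "rank A = card (rows A)"
      unfolding row_rank_def_gen by (rule vec.dim_eq_card_independent)
    also have "\<dots> = CARD('m)" unfolding rows by (rule card_image[OF inj])
    finally show "\<not> rank A < CARD('m)" by simp
  next
    assume "\<not> rank A < CARD('m)"
    moreover have fin: "finite (rows A)" by (simp add: rows)
    moreover have "vec.dim (rows A) \<le> card (rows A)" by (rule vec.dim_le_card[OF vec.span_superset fin])
    moreover have "card (rows A) \<le> CARD('m)" unfolding rows by (rule card_image_le) simp
    ultimately have card: "card (rows A) = CARD('m)" "card (rows A) = vec.dim (rows A)"
      by (auto simp: row_rank_def_gen)
    have inj: "inj (\<lambda>i. row i A)" using card(1) unfolding rows by (intro eq_card_imp_inj_on) auto
    have indep: "vec.independent (rows A)"
      using vec.card_eq_dim[OF subset_refl card(2) fin] vec.span_superset by blast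
    show "\<forall>c. (\<Sum>i\<in>UNIV. c i *s row i A) = 0 \<longrightarrow> (\<forall>i. c i = 0)"
    proof (intro allI impI)
      fix c i assume c: "(\<Sum>i\<in>UNIV. c i *s row i A) = 0"
      define f where "f = (\<lambda>v. c (inv_into UNIV (\<lambda>i. row i A) v))"
      have fc: "f (row i A) = c i" for i using inj by (simp add: f_def inv_f_f[OF inj])
      have "(\<Sum>v\<in>rows A. f v *s v) = 0" using c reindex[OF inj, of f] by (simp add: fc)
      from vec.independentD[OF indep fin subset_refl this, of "row i A"] show "c i = 0"
        by (simp add: fc rows)
    qed
  qed
qed

text \<open>For a right inverse \<open>B\<close> at \<open>z\<close>, the determinant of
  \<open>M w ** B\<close> is continuous in \<open>w\<close> and nonzero at \<open>z\<close>; where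
  it is nonzero, \<open>M w\<close> is still right invertible.\<close>

lemma open_Diff_Sing:
  fixes F :: "(complex, 'n::finite) vec \<Rightarrow> (complex, 'p::finite) vec"
  assumes diff: "\<And>z i. z \<in> ball 0 r \<Longrightarrow> complex_differentiable_at (\<lambda>z. F z $ i) z"
  shows "open (ball 0 r - Sing F)"
proof -
  \<comment> \<open>The Jacobian written with directional derivatives, whose continuity comes from
    Cauchy's formula.\<close>
  define M where "M = (\<lambda>z. (\<chi> i j. dir_deriv (axis j 1) (\<lambda>z. F z $ i) z) :: complex ^ 'n ^ 'p)"
  have jac: "matrix (frechet_derivative F (at z)) = M z" if z: "z \<in> ball 0 r" for z
  proof -
    obtain f' where f': "\<And>i. ((\<lambda>z. F z $ i) has_derivative f' i) (at z)" "\<And>i c v. f' i (c *s v) = c * f' i v"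
      using diff[OF z] unfolding complex_differentiable_at_def by metis
    have "((\<lambda>z. \<chi> i. F z $ i) has_derivative (\<lambda>v. \<chi> i. f' i v)) (at z)"
      by (rule has_derivative_vec_lambda) (rule f'(1))
    then have "frechet_derivative F (at z) = (\<lambda>v. \<chi> i. f' i v)"
      using frechet_derivative_at by fastforce
    moreover have "f' i (axis j 1) = dir_deriv (axis j 1) (\<lambda>z. F z $ i) z" for i j
      using has_field_derivative_line[of "\<lambda>z. F z $ i" "f' i" z 0 "axis j 1"] f'
      by (simp add: dir_deriv_def DERIV_imp_deriv)
    ultimately show ?thesis by (simp add: M_def matrix_def)
  qed
  have cont: "continuous_on (ball 0 r) M"
    unfolding M_def
    by (intro continuous_on_vec_lambda gholo_continuous_on gholo_dir_deriv
        complex_differentiable_at_imp_gholo diff) auto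
  show ?thesis
    unfolding open_subopen[of "ball 0 r - Sing F"]
  proof
    fix z assume "z \<in> ball 0 r - Sing F"
    then have z: "z \<in> ball 0 r" "z \<notin> Sing F" by auto
    then obtain B where B: "M z ** B = mat 1"
      using right_invertible_iff_rank[of "M z"] by (auto simp: Sing_def jac)
    define V where "V = ball 0 r \<inter> (\<lambda>w. det (M w ** B)) -` (- {0})"
    have contM: "continuous_on (ball 0 r) (\<lambda>w. M w $ i $ j)" for i j
      by (intro continuous_on_component cont)
    have "continuous_on (ball 0 r) (\<lambda>w. det (M w ** B))"
      unfolding det_def matrix_matrix_mult_def by (auto intro!: continuous_intros contM)
    then have "open V" unfolding V_def by (rule continuous_open_preimage) auto
    moreover have "z \<in> V" using z(1) B by (simp add: V_def)
    moreover have "V \<subseteq> ball 0 r - Sing F"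
    proof
      fix w assume w: "w \<in> V"
      then have "invertible (M w ** B)" by (simp add: V_def invertible_det_nz)
      then obtain C where "(M w ** B) ** C = mat 1" by (auto simp: invertible_def)
      then have "\<exists>B. M w ** B = mat 1" by (metis matrix_mul_assoc)
      then show "w \<in> ball 0 r - Sing F"
        using w right_invertible_iff_rank[of "M w"] by (simp add: Sing_def jac V_def)
    qed
    ultimately show "\<exists>V. open V \<and> z \<in> V \<and> V \<subseteq> ball 0 r - Sing F" by blast
  qed
qed

section \<open>Well-defined images as set germs\<close>

lemma set_germ_eqI:
  assumes "\<delta> > 0" "A \<inter> ball 0 \<delta> \<subseteq> B" "\<delta>' > 0" "B \<inter> ball 0 \<delta>' \<subseteq> A"
  shows "set_germ_eq A B"
  unfolding set_germ_eq_def using assms by (intro exI[of _ "min \<delta> \<delta>'"]) auto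

lemma well_defined_image_if_isolated:
  fixes F :: "'a::euclidean_space \<Rightarrow> 'b::real_normed_vector"
  assumes r: "r > 0" and cont: "continuous_on (ball 0 r) F" and op: "open (ball 0 r - S)"
    and iso: "\<And>x. x \<in> S \<Longrightarrow> x \<in> ball 0 r \<Longrightarrow> F x = 0 \<Longrightarrow> x = 0"
  shows "well_defined_image F S"
proof -
  have *: "\<exists>\<delta>>0. F ` (ball 0 \<epsilon> \<inter> S) \<inter> ball 0 \<delta> \<subseteq> F ` (ball 0 \<epsilon>' \<inter> S)" if "0 < \<epsilon>'" "\<epsilon> < r" for \<epsilon> \<epsilon>'
  proof -
    \<comment> \<open>As \<open>\<epsilon> < r\<close>, this is the part of \<open>S\<close> between
      the spheres, written as a compact set minus open sets.\<close>
    define K where "K = cball 0 \<epsilon> - ball 0 \<epsilon>' - (ball 0 r - S)"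
    have "compact K" unfolding K_def by (intro compact_diff compact_cball open_ball op)
    moreover have "continuous_on K (\<lambda>x. norm (F x))"
      by (intro continuous_intros continuous_on_subset[OF cont]) (use that in \<open>auto simp: K_def\<close>)
    moreover have pos: "norm (F x) > 0" if "x \<in> K" for x
      using iso[of x] that \<open>\<epsilon> < r\<close> \<open>0 < \<epsilon>'\<close> by (auto simp: K_def)
    ultimately obtain \<delta> where \<delta>: "\<delta> > 0" "\<And>x. x \<in> K \<Longrightarrow> \<delta> \<le> norm (F x)"
    proof (cases "K = {}")
      case False
      then obtain x0 where "x0 \<in> K" "\<forall>x\<in>K. norm (F x0) \<le> norm (F x)"
        using continuous_attains_inf[OF \<open>compact K\<close> False \<open>continuous_on K _\<close>] by blast
      then show ?thesis using pos that by blast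
    \<comment> \<open>\<open>K\<close> is empty for instance if
      \<open>\<epsilon> < \<epsilon>'\<close>; then any bound serves.\<close>
    qed (auto intro: that[of 1])
    have "F ` (ball 0 \<epsilon> \<inter> S) \<inter> ball 0 \<delta> \<subseteq> F ` (ball 0 \<epsilon>' \<inter> S)"
    proof
      fix y assume "y \<in> F ` (ball 0 \<epsilon> \<inter> S) \<inter> ball 0 \<delta>"
      then obtain x where x: "x \<in> ball 0 \<epsilon>" "x \<in> S" "y = F x" "norm (F x) < \<delta>" by auto
      then have "x \<notin> K" using \<delta>(2) by force
      then have "x \<in> ball 0 \<epsilon>'" using x by (auto simp: K_def)
      then show "y \<in> F ` (ball 0 \<epsilon>' \<inter> S)" using x by blast
    qed
    then show ?thesis using \<delta>(1) by blast
  qed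
  have "set_germ_eq (F ` (ball 0 \<epsilon> \<inter> S)) (F ` (ball 0 \<epsilon>' \<inter> S))"
    if small: "0 < \<epsilon> \<and> \<epsilon> < r \<and> 0 < \<epsilon>' \<and> \<epsilon>' < r" for \<epsilon> \<epsilon>'
  proof -
    obtain \<delta> \<delta>' where "\<delta> > 0" "F ` (ball 0 \<epsilon> \<inter> S) \<inter> ball 0 \<delta> \<subseteq> F ` (ball 0 \<epsilon>' \<inter> S)"
      "\<delta>' > 0" "F ` (ball 0 \<epsilon>' \<inter> S) \<inter> ball 0 \<delta>' \<subseteq> F ` (ball 0 \<epsilon> \<inter> S)"
      using *[of \<epsilon>' \<epsilon>] *[of \<epsilon> \<epsilon>'] small by blast
    then show ?thesis by (rule set_germ_eqI)
  qed
  then show ?thesis unfolding well_defined_image_def using r by blast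
qed

theorem proposition2p3:
  fixes F :: "(complex, 'n::finite) vec \<Rightarrow> (complex, 'p::finite) vec"
  assumes "CARD('p) \<le> CARD('n)"
    and "holomorphic_map_germ F"
    and "germ_dim {z. F z = 0} = enat (CARD('n) - CARD('p))"
  shows "image_germ_eq F UNIV UNIV \<and>
         (set_germ_eq (Sing F \<inter> {z. F z = 0}) {0} \<longrightarrow> nice_map_germ F)"
proof -
  have F0: "F 0 = 0" and hol: "\<And>i. holomorphic_near_0 (\<lambda>z. F z $ i)"
    using assms(2) by (simp_all add: holomorphic_map_germ_def)
  have "\<exists>r>0. \<forall>z\<in>ball 0 r. complex_differentiable_at (\<lambda>z. F z $ i) z" for i
    using hol[of i] unfolding holomorphic_near_0_def by (meson open_contains_ball subsetD)
  then have "\<exists>r>0. r \<le> 1 \<and> (\<forall>i. \<forall>z\<in>ball 0 r. complex_differentiable_at (\<lambda>z. F z $ i) z)"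
    by (rule uniform_radius) auto
  then obtain r0 where r0: "r0 > 0"
    and diff: "\<And>z i. z \<in> ball 0 r0 \<Longrightarrow> complex_differentiable_at (\<lambda>z. F z $ i) z" by blast
  have gholo: "gholo (ball 0 r0) (\<lambda>z. F z $ i)" for i
    by (rule complex_differentiable_at_imp_gholo) (rule diff)
  have surj: "\<exists>\<delta>>0. ball 0 \<delta> \<subseteq> F ` ball 0 \<epsilon>" if "\<epsilon> > 0" for \<epsilon>
    using image_contains_ball[OF assms(1) r0 gholo F0 _ that] assms(3) by simp
  have germ: "set_germ_eq (F ` (ball 0 \<epsilon> \<inter> UNIV)) UNIV" if "\<epsilon> > 0" for \<epsilon>
    using surj[OF that] unfolding set_germ_eq_def by auto
  have wd: "well_defined_image F UNIV"
    unfolding well_defined_image_def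
  proof (intro exI[of _ 1] conjI allI impI)
    fix \<epsilon> \<epsilon>' :: real assume "0 < \<epsilon> \<and> \<epsilon> < 1 \<and> 0 < \<epsilon>' \<and> \<epsilon>' < 1"
    then obtain a b where "a > 0" "ball 0 a \<subseteq> F ` ball 0 \<epsilon>" "b > 0" "ball 0 b \<subseteq> F ` ball 0 \<epsilon>'"
      using surj by metis
    then show "set_germ_eq (F ` (ball 0 \<epsilon> \<inter> UNIV)) (F ` (ball 0 \<epsilon>' \<inter> UNIV))"
      by (intro set_germ_eqI[of b _ _ a]) auto
  qed simp
  have "image_germ_eq F UNIV UNIV"
    unfolding image_germ_eq_def using wd germ by (auto intro!: exI[of _ 1])
  moreover have "nice_map_germ F" if sing: "set_germ_eq (Sing F \<inter> {z. F z = 0}) {0}"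
  proof -
    obtain r1 where r1: "r1 > 0" "Sing F \<inter> {z. F z = 0} \<inter> ball 0 r1 = {0} \<inter> ball 0 r1"
      using sing by (auto simp: set_germ_eq_def)
    have "well_defined_image F (Sing F)"
    proof (rule well_defined_image_if_isolated[where r = "min r0 r1"])
      show "continuous_on (ball 0 (min r0 r1)) F"
        by (rule continuous_on_subset[OF gholo_imp_continuous_vec[OF gholo]]) auto
      show "open (ball 0 (min r0 r1) - Sing F)"
        by (rule open_Diff_Sing, rule diff) simp
      show "x = 0" if "x \<in> Sing F" "x \<in> ball 0 (min r0 r1)" "F x = 0" for x
      proof -
        have "x \<in> Sing F \<inter> {z. F z = 0} \<inter> ball 0 r1" using that by simp
        then show ?thesis unfolding r1(2) by simp
      qed
    qed (use r0 r1 in auto)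
    then show ?thesis using wd by (simp add: nice_map_germ_def)
  qed
  ultimately show ?thesis by blast
qed

end
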